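(* Consider the controllable LTI system $x_{t+1}=Ax_t+Bu_t$, $y_t=Cx_t+Du_t$ with $x_t\in\mathbb{R}^{n_x}$, $u_t\in\mathbb{R}^{n_u}$, $y_t\in\mathbb{R}^{n_y}$, and let $n$ be its McMillan degree. Let $w^d=(u^d,y^d)$ be a noise-free external trajectory of length $N$ generated exactly by this system, and suppose that $u^d$ is persistently exciting of order $L+n$ (or, more generally, of order $L+\bar n$ for some upper bound $\bar n\ge n$, for instance $\bar n=n_x$). Let $H_L(w^d)$ be the Hankel matrix built from $w^d$. Then for any bounded measurable path cost $c:\mathcal{W}_L\to\mathbb{R}$, $$\inf_{\mu\in\mathcal{M}_{\mathcal{B}}^L}\int_{\mathcal{B}_L}c(w)\,d\mu(w)=\inf_{\nu\in\mathcal{P}(\mathbb{R}^{N-L+1})}\int_{\mathbb{R}^{N-L+1}}c\bigl(H_L(w^d)\,g\bigr)\,d\nu(g).$$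
   Context: $\mathcal{P}(S)$ denotes the Borel probability measures on $S$. The external signal is $w_t=(u_t,y_t)\in\mathbb{R}^{n_u+n_y}$ and $\mathcal{W}_L:=(\mathbb{R}^{n_u+n_y})^L$. The finite-horizon external behavior $\mathcal{B}_L\subseteq\mathcal{W}_L$ is the set of all $(w_0,\dots,w_{L-1})$ with $w_t=(u_t,y_t)$ for which there is a state sequence (with free initial state $x_0$) satisfying the system equations for $t=0,\dots,L-1$. The external behavioral-measure set is $\mathcal{M}_{\mathcal{B}}^L:=\mathcal{P}(\mathcal{B}_L)$, i.e. the Borel probability measures on $\mathcal{W}_L$ supported on $\mathcal{B}_L$. Controllable means that the pair $(A,B)$ is controllable. The McMillan degree is the smallest state dimension of a realization of the transfer function $D+C(zI-A)^{-1}B$. For data $w^d=(w_0^d,\dots,w_{N-1}^d)$ with $w_t^d=(u_t^d,y_t^d)$, $H_L(w^d)\in\mathbb{R}^{L(n_u+n_y)\times(N-L+1)}$ is the block Hankel matrix whose $j$-th column ($j=0,\dots,N-L$) is the stacked window $(w_j^d,w_{j+1}^d,\dots,w_{j+L-1}^d)$. A signal $u^d$ of length $N$ in $\mathbb{R}^{n_u}$ is persistently exciting of order $K$ if its depth-$K$ block Hankel matrix $H_K(u^d)$ has full row rank $Kn_u$. *)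

theory Defs
  imports
    "HOL-Probability.Probability_Measure"
    "Jordan_Normal_Form.DL_Rank"
    "Jordan_Normal_Form.Gauss_Jordan_Elimination"
begin

no_notation Finite_Cartesian_Product.vec_nth (infixl "$" 90)

type_synonym rvec = "real Matrix.vec"

definition lti_system ::
  "nat \<Rightarrow> nat \<Rightarrow> nat \<Rightarrow> real mat \<Rightarrow> real mat \<Rightarrow> real mat \<Rightarrow> real mat \<Rightarrow> bool" where
  "lti_system nx nu ny A B C D \<longleftrightarrow>
     A \<in> carrier_mat nx nx \<and> B \<in> carrier_mat nx nu \<and>
     C \<in> carrier_mat ny nx \<and> D \<in> carrier_mat ny nu"

(* Signals are functions of time; only the samples 0, ..., T-1 of u and y (and 0, ..., T of x)
   are constrained. *)
definition lti_trajectory ::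
  "real mat \<Rightarrow> real mat \<Rightarrow> real mat \<Rightarrow> real mat \<Rightarrow> nat \<Rightarrow>
   (nat \<Rightarrow> rvec) \<Rightarrow> (nat \<Rightarrow> rvec) \<Rightarrow> (nat \<Rightarrow> rvec) \<Rightarrow> bool" where
  "lti_trajectory A B C D T x u y \<longleftrightarrow>
     x 0 \<in> carrier_vec (dim_row A) \<and>
     (\<forall>t<T. u t \<in> carrier_vec (dim_col B) \<and>
            x (Suc t) = A *\<^sub>v x t + B *\<^sub>v u t \<and>
            y t = C *\<^sub>v x t + D *\<^sub>v u t)"

definition controllable :: "real mat \<Rightarrow> real mat \<Rightarrow> bool" where
  "controllable A B \<longleftrightarrow>
     (\<forall>a \<in> carrier_vec (dim_row A). \<forall>b \<in> carrier_vec (dim_row A).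
        \<exists>T x u. x 0 = a \<and> x T = b \<and>
          (\<forall>t<T. u t \<in> carrier_vec (dim_col B) \<and> x (Suc t) = A *\<^sub>v x t + B *\<^sub>v u t))"

definition resolvent_pencil :: "real mat \<Rightarrow> complex \<Rightarrow> complex mat" where
  "resolvent_pencil A z = z \<cdot>\<^sub>m 1\<^sub>m (dim_row A) - map_mat complex_of_real A"

(* Meaningful only where the pencil is invertible, i.e. off the finite spectrum of A. *)
definition transfer_function ::
  "real mat \<Rightarrow> real mat \<Rightarrow> real mat \<Rightarrow> real mat \<Rightarrow> complex \<Rightarrow> complex mat" where
  "transfer_function A B C D z =
     map_mat complex_of_real D +
     map_mat complex_of_real C * the (mat_inverse (resolvent_pencil A z)) *
     map_mat complex_of_real B"

(* Rational matrix functions are equal iff they agree wherever both expressions are defined,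
   since this excludes only finitely many points. *)
definition same_transfer_function ::
  "real mat \<Rightarrow> real mat \<Rightarrow> real mat \<Rightarrow> real mat \<Rightarrow>
   real mat \<Rightarrow> real mat \<Rightarrow> real mat \<Rightarrow> real mat \<Rightarrow> bool" where
  "same_transfer_function A B C D A' B' C' D' \<longleftrightarrow>
     (\<forall>z. invertible_mat (resolvent_pencil A z) \<and> invertible_mat (resolvent_pencil A' z) \<longrightarrow>
          transfer_function A B C D z = transfer_function A' B' C' D' z)"

definition mcmillan_degree :: "real mat \<Rightarrow> real mat \<Rightarrow> real mat \<Rightarrow> real mat \<Rightarrow> nat" where
  "mcmillan_degree A B C D =
     (LEAST m. \<exists>A' B' C' D'. lti_system m (dim_col B) (dim_row C) A' B' C' D' \<and>
                 same_transfer_function A B C D A' B' C' D')"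

definition stack :: "nat \<Rightarrow> nat \<Rightarrow> (nat \<Rightarrow> rvec) \<Rightarrow> rvec" where
  "stack q L w = Matrix.vec (L * q) (\<lambda>i. w (i div q) $ (i mod q))"

(* The block Hankel matrix of depth L of the samples w 0, ..., w (N - 1), each of dimension q.
   The number of columns is written N + 1 - L, so that truncated subtraction gives no column
   when N < L. *)
definition hankel :: "nat \<Rightarrow> nat \<Rightarrow> nat \<Rightarrow> (nat \<Rightarrow> rvec) \<Rightarrow> real mat" where
  "hankel q L N w = mat_of_cols (L * q) (map (\<lambda>j. stack q L (\<lambda>t. w (j + t))) [0..<N + 1 - L])"

definition persistently_exciting :: "nat \<Rightarrow> nat \<Rightarrow> nat \<Rightarrow> (nat \<Rightarrow> rvec) \<Rightarrow> bool" where
  "persistently_exciting nu K N u \<longleftrightarrow> vec_space.rank (K * nu) (hankel nu K N u) = K * nu"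

definition external_behavior ::
  "real mat \<Rightarrow> real mat \<Rightarrow> real mat \<Rightarrow> real mat \<Rightarrow> nat \<Rightarrow> rvec set" where
  "external_behavior A B C D L =
     {stack (dim_col B + dim_row C) L (\<lambda>t. u t @\<^sub>v y t) | u y.
        \<exists>x. lti_trajectory A B C D L x u y}"

(* The Borel sigma-algebra of R^d, transported along the coordinate bijection from the
   d-fold product of the Borel sigma-algebra of the reals. *)
definition borel_vec :: "nat \<Rightarrow> rvec measure" where
  "borel_vec d =
     vimage_algebra (carrier_vec d) (\<lambda>v. \<lambda>i\<in>{..<d}. v $ i) (PiM {..<d} (\<lambda>_. borel))"

(* The Borel sigma-algebra of a subset S of R^d is the trace of that of R^d. *)
definition borel_probs :: "nat \<Rightarrow> rvec set \<Rightarrow> rvec measure set" where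
  "borel_probs d S = {\<mu>. prob_space \<mu> \<and> sets \<mu> = sets (restrict_space (borel_vec d) S)}"

end

theory Submission
  imports Defs "HOL-Probability.Giry_Monad"
begin

unbundle no inner_syntax

text \<open>
  Averaging a bounded cost over probability measures on a set \<open>S\<close> gives the same infimum as
  evaluating it at the points of \<open>S\<close>: no average lies below the infimum, and Dirac measures attain
  the point values. This holds on both sides (\<open>INF_borel_probs_eq_INF_points\<close>), where on the right the
  cost is composed with the measurable map \<open>g \<mapsto> H g\<close>. The theorem therefore reduces to
  Willems' fundamental lemma: the external behavior is the column space of the data Hankel matrix
  (\<open>external_behavior_eq_hankel_range\<close>).

  The columns are trajectories and the behavior is a linear space, which gives one inclusion. For the
  other, a column space is the set of vectors killed by every functional that kills the columns
  (\<open>in_range_if_annihilated\<close>), so let a functional kill every data window. Substituting the output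
  equation turns it into a relation \<open>\<eta> \<bullet> x j + (\<Sum>i<L. \<alpha> i \<bullet> u (j + i)) = 0\<close> valid at all times \<open>j\<close> in the
  data (\<open>external_functional_along_trajectory\<close>). If a monic polynomial \<open>p\<close> of degree \<open>d\<close> satisfies
  \<open>\<eta>\<^sup>T p(A) = 0\<close>, combining \<open>d + 1\<close> shifted relations eliminates the state and leaves a relation between
  \<open>L + d\<close> consecutive inputs. Persistency of excitation forces its coefficients to be zero, and
  unravelling them with controllability gives \<open>\<alpha> = 0\<close> and \<open>\<eta> = 0\<close> (\<open>hankel_annihilator_vanishes\<close>).

  The order of excitation refers to the McMillan degree \<open>n\<close> and not to the dimension of the given
  state, so \<open>d \<le> n\<close> is required. By controllability, \<open>\<eta>\<^sup>T p(A) = 0\<close> follows from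
  \<open>\<eta>\<^sup>T p(A) A ^ j B = 0\<close> for all \<open>j\<close>. Since \<open>\<eta>\<close> is built from output weights, these numbers are combinations
  of the Markov parameters \<open>C A ^ k B\<close>, which the transfer function determines through its expansion at
  infinity (\<open>markov_parameters_eq\<close>). They may be computed in a realization of dimension \<open>n\<close>, where a
  polynomial of degree at most \<open>n\<close> exists because \<open>n + 1\<close> vectors are dependent
  (\<open>costate_monic_recurrence\<close>).
\<close>

section \<open>Least squares and annihilators\<close>

text \<open>
  The least-squares problem is solved by adding one vector at a time, as in the Gram-Schmidt
  process: the new vector is replaced by its residual \<open>e\<close> against the earlier ones, and a multiple
  of \<open>e\<close> is removed from the residual of \<open>w\<close>.
\<close>

lemma exists_orthogonal_residual_fun:
  fixes v :: "nat \<Rightarrow> nat \<Rightarrow> real"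
  shows "\<exists>g. \<forall>j<p. (\<Sum>i<d. (w i - (\<Sum>k<p. g k * v k i)) * v j i) = 0"
proof (induction p arbitrary: w)
  case 0
  show ?case by simp
next
  case (Suc p)
  obtain a where a: "\<And>j. j < p \<Longrightarrow> (\<Sum>i<d. (v p i - (\<Sum>k<p. a k * v k i)) * v j i) = 0"
    using Suc[of "v p"] by blast
  obtain b where b: "\<And>j. j < p \<Longrightarrow> (\<Sum>i<d. (w i - (\<Sum>k<p. b k * v k i)) * v j i) = 0"
    using Suc[of w] by blast
  define r where "r i = w i - (\<Sum>k<p. b k * v k i)" for i
  define e where "e i = v p i - (\<Sum>k<p. a k * v k i)" for i
  (* If e = 0, division by zero gives t = 0, which is a correct choice then. *)
  define t where "t = (\<Sum>i<d. r i * e i) / (\<Sum>i<d. e i * e i)"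
  define g where "g k = (if k < p then b k - t * a k else t)" for k
  have res: "w i - (\<Sum>k<Suc p. g k * v k i) = r i - t * e i" for i
  proof -
    have "(\<Sum>k<p. g k * v k i) = (\<Sum>k<p. b k * v k i) - t * (\<Sum>k<p. a k * v k i)"
      unfolding g_def by (simp add: sum_distrib_left sum_subtractf[symmetric] algebra_simps)
    then show ?thesis
      by (simp add: r_def e_def g_def algebra_simps)
  qed
  have orth: "(\<Sum>i<d. (r i - t * e i) * v j i) = 0" if "j < p" for j
  proof -
    have "(\<Sum>i<d. (r i - t * e i) * v j i) = (\<Sum>i<d. r i * v j i) - t * (\<Sum>i<d. e i * v j i)"
      by (simp add: sum_distrib_left sum_subtractf[symmetric] algebra_simps)
    then show ?thesis using a[OF that] b[OF that] by (simp add: r_def e_def)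
  qed
  have te: "t * (\<Sum>i<d. e i * e i) = (\<Sum>i<d. r i * e i)"
  proof (cases "(\<Sum>i<d. e i * e i) = 0")
    case True
    then have "\<forall>i<d. e i = 0"
      by (simp add: sum_nonneg_eq_0_iff)
    then show ?thesis by simp
  qed (simp add: t_def)
  have "(\<Sum>i<d. (r i - t * e i) * v p i) =
        (\<Sum>i<d. (r i - t * e i) * e i + (\<Sum>k<p. a k * ((r i - t * e i) * v k i)))"
    by (intro sum.cong refl) (simp add: e_def algebra_simps sum_distrib_left sum_subtractf)
  also have "\<dots> = (\<Sum>i<d. (r i - t * e i) * e i) +
        (\<Sum>k<p. a k * (\<Sum>i<d. (r i - t * e i) * v k i))"
    by (subst sum_distrib_left) (simp add: sum.distrib sum.swap[of _ "{..<p}"])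
  also have "(\<Sum>k<p. a k * (\<Sum>i<d. (r i - t * e i) * v k i)) = 0"
    using orth by simp
  also have "(\<Sum>i<d. (r i - t * e i) * e i) = 0"
    using te by (simp add: sum_distrib_left sum_subtractf algebra_simps)
  finally have "(\<Sum>i<d. (r i - t * e i) * v p i) = 0" by simp
  with orth have "\<forall>j<Suc p. (\<Sum>i<d. (r i - t * e i) * v j i) = 0"
    by (simp add: less_Suc_eq)
  then show ?case using res by (intro exI[of _ g]) simp
qed

lemma scalar_prod_self_eq_0_iff:
  fixes v :: rvec
  assumes "v \<in> carrier_vec n"
  shows "v \<bullet> v = 0 \<longleftrightarrow> v = 0\<^sub>v n"
proof
  assume "v \<bullet> v = 0"
  then have "\<forall>i\<in>{0..<n}. v $ i * v $ i = 0"
    using assms unfolding scalar_prod_def by (subst (asm) sum_nonneg_eq_0_iff) auto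
  then show "v = 0\<^sub>v n" using assms by (intro eq_vecI) auto
qed (use assms in simp)

lemma scalar_prod_mult_mat_vec_cols:
  fixes M :: "real mat"
  assumes "M \<in> carrier_mat d p" "r \<in> carrier_vec d" "g \<in> carrier_vec p"
    and "\<And>j. j < p \<Longrightarrow> r \<bullet> col M j = 0"
  shows "r \<bullet> (M *\<^sub>v g) = 0"
proof -
  have "M\<^sup>T *\<^sub>v r = 0\<^sub>v p"
    using assms by (intro eq_vecI) (auto simp: comm_scalar_prod[of r d])
  then show ?thesis
    using transpose_vec_mult_scalar[OF assms(1,3,2)] assms(3) by simp
qed

text \<open>
  The column space of a real matrix is its own double annihilator: the least-squares residual of
  \<open>w\<close> is orthogonal to the columns, hence to \<open>w\<close> and to the fitted vector, hence to itself.
\<close>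

lemma in_range_if_annihilated:
  fixes M :: "real mat"
  assumes M: "M \<in> carrier_mat d p" and w: "w \<in> carrier_vec d"
    and ann: "\<And>r. r \<in> carrier_vec d \<Longrightarrow> (\<And>j. j < p \<Longrightarrow> r \<bullet> col M j = 0) \<Longrightarrow> r \<bullet> w = 0"
  shows "\<exists>g \<in> carrier_vec p. w = M *\<^sub>v g"
proof -
  obtain g where g: "\<And>j. j < p \<Longrightarrow> (\<Sum>i<d. (w $ i - (\<Sum>k<p. g k * M $$ (i, k))) * M $$ (i, j)) = 0"
    using exists_orthogonal_residual_fun[where v = "\<lambda>k i. M $$ (i, k)" and w = "\<lambda>i. w $ i" and p = p and d = d]
    by blast
  define G where "G = Matrix.vec p g"
  define r where "r = w - M *\<^sub>v G"
  have G: "G \<in> carrier_vec p" and MG: "M *\<^sub>v G \<in> carrier_vec d" and r: "r \<in> carrier_vec d"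
    using M w by (auto simp: G_def r_def)
  have orth: "r \<bullet> col M j = 0" if "j < p" for j
    using g[OF that] M w that
    by (simp add: r_def G_def scalar_prod_def atLeast0LessThan mult.commute)
  have "r \<bullet> r = r \<bullet> w - r \<bullet> (M *\<^sub>v G)"
    unfolding r_def using w MG by (intro scalar_prod_minus_distrib) auto
  also have "\<dots> = 0"
    using ann[OF r orth] scalar_prod_mult_mat_vec_cols[OF M r G orth] by simp
  finally have "r = 0\<^sub>v d" using scalar_prod_self_eq_0_iff[OF r] by simp
  then have "w $ i = (M *\<^sub>v G) $ i" if "i < d" for i
  proof -
    have "w $ i - (M *\<^sub>v G) $ i = r $ i"
      using that MG M unfolding r_def by (subst index_minus_vec) auto
    then show ?thesis using \<open>r = 0\<^sub>v d\<close> that by simp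
  qed
  then have "w = M *\<^sub>v G" using w MG M by (intro eq_vecI) auto
  with G show ?thesis by blast
qed

text \<open>
  Linear combinations of columns stay in any set closed under the vector space operations; the
  induction is over the partial combinations of the first \<open>k\<close> columns.
\<close>

lemma mult_mat_vec_in_subspace:
  fixes M :: "real mat"
  assumes M: "M \<in> carrier_mat d p" and g: "g \<in> carrier_vec p"
    and zero: "0\<^sub>v d \<in> S"
    and add: "\<And>v w. v \<in> S \<Longrightarrow> w \<in> S \<Longrightarrow> v + w \<in> S"
    and smult: "\<And>a v. v \<in> S \<Longrightarrow> a \<cdot>\<^sub>v v \<in> S"
    and cols: "\<And>j. j < p \<Longrightarrow> col M j \<in> S"
  shows "M *\<^sub>v g \<in> S"
proof -
  have "Matrix.vec d (\<lambda>i. \<Sum>j<k. M $$ (i, j) * g $ j) \<in> S" if "k \<le> p" for k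
    using that
  proof (induction k)
    case 0
    then show ?case using zero by (simp add: zero_vec_def)
  next
    case (Suc k)
    have "Matrix.vec d (\<lambda>i. \<Sum>j<Suc k. M $$ (i, j) * g $ j) =
        Matrix.vec d (\<lambda>i. \<Sum>j<k. M $$ (i, j) * g $ j) + g $ k \<cdot>\<^sub>v col M k"
      using M Suc.prems by (intro eq_vecI) auto
    then show ?case using Suc by (auto intro!: add smult cols)
  qed
  from this[of p] have "Matrix.vec d (\<lambda>i. \<Sum>j<p. M $$ (i, j) * g $ j) \<in> S" by simp
  also have "Matrix.vec d (\<lambda>i. \<Sum>j<p. M $$ (i, j) * g $ j) = M *\<^sub>v g"
    using M g by (intro eq_vecI) (auto simp: scalar_prod_def atLeast0LessThan)
  finally show ?thesis .
qed

text \<open>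
  With rank equal to the number of rows, some columns form a basis of the whole space, so a
  vector orthogonal to all columns is a combination of vectors orthogonal to it.
\<close>

lemma full_row_rank_left_kernel:
  fixes M :: "real mat"
  assumes M: "M \<in> carrier_mat n p" and rank: "vec_space.rank n M = n"
    and r: "r \<in> carrier_vec n" and ann: "\<And>j. j < p \<Longrightarrow> r \<bullet> col M j = 0"
  shows "r = 0\<^sub>v n"
proof -
  interpret vec_space "TYPE(real)" n .
  have colsn: "set (cols M) \<subseteq> carrier_vec n" using M cols_dim by blast
  obtain U where U: "maximal U (\<lambda>T. T \<subseteq> set (cols M) \<and> lin_indpt T)"
    using maximal_exists_superset[of "set (cols M)" "\<lambda>T. T \<subseteq> set (cols M) \<and> lin_indpt T" "{}"] finite_lin_indpt2[of "{}"]
    by auto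
  then have Us: "U \<subseteq> set (cols M)" and li: "lin_indpt U" by (auto simp: maximal_def)
  have fin: "finite U" using Us finite_subset by blast
  have Uc: "U \<subseteq> carrier_vec n" using Us colsn by blast
  have "card U = n" using rank_card_indpt[OF M U] rank by simp
  then have "basis U"
    using dim_li_is_basis[OF fin_dim fin] Uc li dim_is_n by simp
  then have "r \<in> span U" using r unfolding basis_def by simp
  then obtain a where a: "r = lincomb a U"
    using finite_in_span[OF fin] Uc by auto
  have "lincomb a U \<bullet> r = (\<Sum>u\<in>U. (a u \<cdot>\<^sub>v u) \<bullet> r)"
    unfolding lincomb_def using Uc r by (subst finsum_scalar_prod_sum) auto
  also have "\<dots> = 0"
  proof (intro sum.neutral ballI)
    fix u assume "u \<in> U"
    then obtain j where "j < p" "u = col M j"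
      using Us M by (auto simp: cols_def)
    moreover have "u \<in> carrier_vec n" using \<open>u \<in> U\<close> Uc by blast
    ultimately have "u \<bullet> r = 0" using ann r comm_scalar_prod by metis
    then show "(a u \<cdot>\<^sub>v u) \<bullet> r = 0" using \<open>u \<in> carrier_vec n\<close> r by simp
  qed
  finally have "r \<bullet> r = 0" using a by simp
  then show ?thesis using scalar_prod_self_eq_0_iff[OF r] by simp
qed

section \<open>Markov parameters and the transfer function\<close>

text \<open>
  Functionals on the state are propagated backwards in time, so that the row vector
  \<open>\<eta>\<^sup>T A ^ k\<close> is kept as the column vector \<open>(A\<^sup>T) ^ k \<eta>\<close>.
\<close>

definition costate :: "real mat \<Rightarrow> nat \<Rightarrow> rvec \<Rightarrow> rvec" where
  "costate A k = ((*\<^sub>v) A\<^sup>T) ^^ k"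

lemma costate_0 [simp]: "costate A 0 v = v"
  by (simp add: costate_def)

lemma costate_Suc: "costate A (Suc k) v = A\<^sup>T *\<^sub>v costate A k v"
  by (simp add: costate_def)

lemma costate_Suc': "costate A (Suc k) v = costate A k (A\<^sup>T *\<^sub>v v)"
  by (simp add: costate_def funpow_swap1)

lemma costate_carrier [simp]:
  assumes "A \<in> carrier_mat n n" "v \<in> carrier_vec n"
  shows "costate A k v \<in> carrier_vec n"
  using assms by (induction k) (auto simp: costate_Suc)

lemma costate_add:
  assumes "A \<in> carrier_mat n n" "v \<in> carrier_vec n" "w \<in> carrier_vec n"
  shows "costate A k (v + w) = costate A k v + costate A k w"
  using assms by (induction k) (auto simp: costate_Suc mult_add_distrib_mat_vec[of _ n n])

lemma costate_Suc_scalar_prod: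
  assumes "A \<in> carrier_mat n n" "v \<in> carrier_vec n" "x \<in> carrier_vec n"
  shows "costate A (Suc k) v \<bullet> x = costate A k v \<bullet> (A *\<^sub>v x)"
  unfolding costate_Suc using assms by (intro transpose_vec_mult_scalar) auto

text \<open>
  At infinity \<open>\<phi> 0\<close> has the asymptotic series \<open>\<Sum>k. M k / z ^ (k + 1)\<close>, whose \<open>k\<close>-th remainder, scaled
  by \<open>z ^ k\<close>, is \<open>\<phi> k\<close>. Coefficients are compared one after the other: once \<open>\<phi> k\<close> and \<open>\<psi> k\<close> agree for
  large \<open>z\<close>, the constant \<open>M' k - M k\<close> is a difference of functions that vanish at infinity. A
  constant difference of \<open>\<phi> 0\<close> and \<open>\<psi> 0\<close> (the feedthrough terms) vanishes for the same reason.
\<close>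

lemma asymptotic_coefficients_unique:
  fixes \<phi> \<psi> :: "nat \<Rightarrow> real \<Rightarrow> complex"
  assumes lim: "\<And>k. (\<phi> k \<longlongrightarrow> 0) at_top" "\<And>k. (\<psi> k \<longlongrightarrow> 0) at_top"
    and rec_\<phi>: "\<And>k. \<forall>\<^sub>F z in at_top. of_real z * \<phi> k z = M k + \<phi> (Suc k) z"
    and rec_\<psi>: "\<And>k. \<forall>\<^sub>F z in at_top. of_real z * \<psi> k z = M' k + \<psi> (Suc k) z"
    and const: "\<forall>\<^sub>F z in at_top. \<phi> 0 z - \<psi> 0 z = K"
  shows "M k = M' k"
proof -
  have const_0: "c = 0" if "\<forall>\<^sub>F z in at_top. \<phi> k z - \<psi> k z = c" for k c
  proof -
    have "((\<lambda>z. \<phi> k z - \<psi> k z) \<longlongrightarrow> 0 - 0) at_top"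
      by (intro tendsto_diff lim)
    moreover have "((\<lambda>z. \<phi> k z - \<psi> k z) \<longlongrightarrow> c) at_top"
      using that by (rule tendsto_eventually)
    ultimately show ?thesis
      using tendsto_unique trivial_limit_at_top_linorder by fastforce
  qed
  have "(\<forall>\<^sub>F z in at_top. \<phi> k z = \<psi> k z) \<Longrightarrow>
      M k = M' k \<and> (\<forall>\<^sub>F z in at_top. \<phi> (Suc k) z = \<psi> (Suc k) z)" for k
  proof -
    assume "\<forall>\<^sub>F z in at_top. \<phi> k z = \<psi> k z"
    with rec_\<phi>[of k] rec_\<psi>[of k]
    have ev: "\<forall>\<^sub>F z in at_top. \<phi> (Suc k) z - \<psi> (Suc k) z = M' k - M k"
      by eventually_elim (simp add: algebra_simps)
    then have eq: "M' k - M k = 0" by (rule const_0)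
    from ev have "\<forall>\<^sub>F z in at_top. \<phi> (Suc k) z = \<psi> (Suc k) z"
      by eventually_elim (use eq in simp)
    with eq show ?thesis by simp
  qed
  note step = this
  have "\<forall>\<^sub>F z in at_top. \<phi> 0 z = \<psi> 0 z"
    using const by (rule eventually_mono) (use const_0[OF const] in simp)
  then have "\<forall>\<^sub>F z in at_top. \<phi> k z = \<psi> k z" for k
    by (induction k) (use step in blast)+
  with step show ?thesis by blast
qed

text \<open>
  The equations say \<open>(z I - a) v = b\<close>. Summing the norms of all components of \<open>z v = b + a v\<close>
  bounds the solution without any formula for the inverse; with \<open>b = 0\<close> the bound shows that the
  system is nonsingular for all these \<open>z\<close>.
\<close>

lemma resolvent_solution_bound:
  fixes v b :: "nat \<Rightarrow> complex" and a :: "nat \<Rightarrow> nat \<Rightarrow> complex"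
  assumes z: "z > (\<Sum>i<n. \<Sum>l<n. norm (a i l))"
    and eq: "\<And>i. i < n \<Longrightarrow> of_real z * v i = b i + (\<Sum>l<n. a i l * v l)"
  shows "(\<Sum>i<n. norm (v i)) \<le> (\<Sum>i<n. norm (b i)) / (z - (\<Sum>i<n. \<Sum>l<n. norm (a i l)))"
proof -
  define s where "s = (\<Sum>i<n. norm (v i))"
  have "0 \<le> (\<Sum>i<n. \<Sum>l<n. norm (a i l))" by (intro sum_nonneg) auto
  then have z0: "0 \<le> z" using z by linarith
  have le_s: "norm (v l) \<le> s" if "l < n" for l
    unfolding s_def by (rule member_le_sum) (use that in auto)
  have "z * s = (\<Sum>i<n. norm (of_real z * v i))"
    using z0 by (simp add: s_def sum_distrib_left norm_mult)
  also have "\<dots> \<le> (\<Sum>i<n. norm (b i) + (\<Sum>l<n. norm (a i l) * s))"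
  proof (intro sum_mono)
    fix i assume "i \<in> {..<n}"
    then have "norm (of_real z * v i) \<le> norm (b i) + norm (\<Sum>l<n. a i l * v l)"
      using eq[of i] norm_triangle_ineq by simp
    also have "norm (\<Sum>l<n. a i l * v l) \<le> (\<Sum>l<n. norm (a i l * v l))"
      by (rule norm_sum)
    also have "\<dots> \<le> (\<Sum>l<n. norm (a i l) * s)"
      using le_s by (intro sum_mono) (simp add: norm_mult mult_left_mono)
    finally show "norm (of_real z * v i) \<le> norm (b i) + (\<Sum>l<n. norm (a i l) * s)" by simp
  qed
  also have "\<dots> = (\<Sum>i<n. norm (b i)) + (\<Sum>i<n. \<Sum>l<n. norm (a i l)) * s"
    by (simp add: sum.distrib sum_distrib_right)
  finally have "s * (z - (\<Sum>i<n. \<Sum>l<n. norm (a i l))) \<le> (\<Sum>i<n. norm (b i))"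
    by (simp add: algebra_simps)
  then show ?thesis using z by (simp add: s_def pos_le_divide_eq)
qed

lemma resolvent_solution_tendsto_0:
  fixes v :: "real \<Rightarrow> nat \<Rightarrow> complex" and a :: "nat \<Rightarrow> nat \<Rightarrow> complex"
  assumes "\<forall>\<^sub>F z in at_top. \<forall>i<n. of_real z * v z i = b i + (\<Sum>l<n. a i l * v z l)"
    and i: "i < n"
  shows "((\<lambda>z. v z i) \<longlongrightarrow> 0) at_top"
proof (rule Lim_null_comparison)
  let ?\<alpha> = "\<Sum>i<n. \<Sum>l<n. norm (a i l)"
  show "\<forall>\<^sub>F z in at_top. norm (v z i) \<le> (\<Sum>i<n. norm (b i)) / (z - ?\<alpha>)"
    using assms(1) eventually_gt_at_top[of ?\<alpha>]
  proof eventually_elim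
    case (elim z)
    have "norm (v z i) \<le> (\<Sum>i<n. norm (v z i))"
      by (rule member_le_sum) (use i in auto)
    also have "\<dots> \<le> (\<Sum>i<n. norm (b i)) / (z - ?\<alpha>)"
      by (rule resolvent_solution_bound) (use elim in auto)
    finally show ?case .
  qed
  have "filterlim (\<lambda>z. - ?\<alpha> + z) at_top at_top"
    by (intro filterlim_tendsto_add_at_top[OF tendsto_const] filterlim_ident)
  then have "filterlim (\<lambda>z. z - ?\<alpha>) at_infinity at_top"
    by (intro filterlim_at_top_imp_at_infinity) simp
  then show "((\<lambda>z. (\<Sum>i<n. norm (b i)) / (z - ?\<alpha>)) \<longlongrightarrow> 0) at_top"
    by (rule tendsto_divide_0[OF tendsto_const])
qed

lemma resolvent_pencil_carrier [simp]:
  "A \<in> carrier_mat n n \<Longrightarrow> resolvent_pencil A z \<in> carrier_mat n n"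
  by (auto simp: resolvent_pencil_def)

lemma resolvent_pencil_mult_index:
  assumes A: "A \<in> carrier_mat n n" and X: "X \<in> carrier_mat n m" and "i < n" "j < m"
  shows "(resolvent_pencil A z * X) $$ (i, j) =
    z * X $$ (i, j) - (\<Sum>l<n. of_real (A $$ (i, l)) * X $$ (l, j))"
proof -
  have "(resolvent_pencil A z * X) $$ (i, j) =
      (\<Sum>l<n. (if i = l then z * X $$ (l, j) else 0) - of_real (A $$ (i, l)) * X $$ (l, j))"
    using assms by (auto simp: resolvent_pencil_def scalar_prod_def atLeast0LessThan algebra_simps
        intro!: sum.cong)
  then show ?thesis using assms by (simp add: sum_subtractf)
qed

lemma eventually_mat_inverse_resolvent_pencil:
  assumes A: "A \<in> carrier_mat n n"
  shows "\<forall>\<^sub>F z in at_top. \<exists>R \<in> carrier_mat n n.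
    mat_inverse (resolvent_pencil A (of_real z)) = Some R \<and>
    resolvent_pencil A (of_real z) * R = 1\<^sub>m n \<and> R * resolvent_pencil A (of_real z) = 1\<^sub>m n"
  using eventually_gt_at_top[of "\<Sum>i<n. \<Sum>l<n. norm (complex_of_real (A $$ (i, l)))"]
proof eventually_elim
  case (elim z)
  let ?P = "resolvent_pencil A (of_real z)"
  have P: "?P \<in> carrier_mat n n" using A by simp
  have "det ?P \<noteq> 0"
  proof
    assume "det ?P = 0"
    then obtain v where v: "v \<in> carrier_vec n" "v \<noteq> 0\<^sub>v n" "?P *\<^sub>v v = 0\<^sub>v n"
      using det_0_iff_vec_prod_zero[OF P] by blast
    define X where "X = mat_of_cols n [v]"
    have X: "X \<in> carrier_mat n 1" and Xv: "\<And>i. i < n \<Longrightarrow> X $$ (i, 0) = v $ i"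
      by (auto simp: X_def mat_of_cols_def)
    have cX: "col X 0 = v" using v by (simp add: X_def)
    have eq: "of_real z * v $ i = 0 + (\<Sum>l<n. of_real (A $$ (i, l)) * v $ l)" if "i < n" for i
    proof -
      have "(?P * X) $$ (i, 0) = (?P *\<^sub>v v) $ i"
        using that P X cX by simp
      then show ?thesis
        using resolvent_pencil_mult_index[OF A X that] Xv that v(3) by simp
    qed
    have "(\<Sum>i<n. norm (v $ i)) \<le> (\<Sum>i<n. norm (0::complex)) /
        (z - (\<Sum>i<n. \<Sum>l<n. norm (complex_of_real (A $$ (i, l)))))"
      by (rule resolvent_solution_bound[OF elim eq])
    then have "(\<Sum>i<n. norm (v $ i)) = 0" by (simp add: sum_nonneg antisym)
    then have "\<forall>i<n. v $ i = 0" by (simp add: sum_nonneg_eq_0_iff)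
    with v show False by (auto intro: eq_vecI)
  qed
  then have "?P \<in> Units (ring_mat TYPE(complex) n ())"
    by (rule det_non_zero_imp_unit[OF P])
  then obtain R where "mat_inverse ?P = Some R"
    using mat_inverse(1)[OF P, where b = "()"] by (cases "mat_inverse ?P") auto
  with mat_inverse(2)[OF P this] show ?case by blast
qed

text \<open>
  With \<open>X\<close> solving \<open>(z I - A) X = B\<close>, the functions are
  \<open>\<phi> k z = b\<^sup>T C A ^ k X z e\<^sub>j\<close>. The recursion is \<open>z X = B + A X\<close> multiplied from the left by \<open>b\<^sup>T C A ^ k\<close>,
  and \<open>\<phi> 0\<close> is the strictly proper part of an entry of \<open>b\<^sup>T G z\<close>. Real \<open>z\<close> suffice, since only the
  behavior at infinity matters.
\<close>

lemma transfer_function_expansion: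
  assumes sys: "lti_system n nu ny A B C D"
    and b: "b \<in> carrier_vec ny" and j: "j < nu"
  obtains \<phi> :: "nat \<Rightarrow> real \<Rightarrow> complex" where
    "\<And>k. (\<phi> k \<longlongrightarrow> 0) at_top"
    "\<And>k. \<forall>\<^sub>F z in at_top. of_real z * \<phi> k z =
       of_real ((B\<^sup>T *\<^sub>v costate A k (C\<^sup>T *\<^sub>v b)) $ j) + \<phi> (Suc k) z"
    "\<forall>\<^sub>F z in at_top. invertible_mat (resolvent_pencil A (of_real z)) \<and>
       (\<Sum>p<ny. of_real (b $ p) * transfer_function A B C D (of_real z) $$ (p, j)) =
       of_real (\<Sum>p<ny. b $ p * D $$ (p, j)) + \<phi> 0 z"
proof -
  have A: "A \<in> carrier_mat n n" and B: "B \<in> carrier_mat n nu"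
    and C: "C \<in> carrier_mat ny n" and D: "D \<in> carrier_mat ny nu"
    using sys by (auto simp: lti_system_def)
  define w where "w k = costate A k (C\<^sup>T *\<^sub>v b)" for k
  have w: "w k \<in> carrier_vec n" for k
    unfolding w_def using A b C by (intro costate_carrier) auto
  define R where "R z = the (mat_inverse (resolvent_pencil A (of_real z)))" for z :: real
  define X where "X z = R z * map_mat complex_of_real B" for z
  define \<phi> where "\<phi> k z = (\<Sum>i<n. of_real (w k $ i) * X z $$ (i, j))" for k z
  have R: "\<forall>\<^sub>F z in at_top. R z \<in> carrier_mat n n \<and>
      resolvent_pencil A (of_real z) * R z = 1\<^sub>m n \<and> invertible_mat (resolvent_pencil A (of_real z))"
    using eventually_mat_inverse_resolvent_pencil[OF A]
  proof eventually_elim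
    case (elim z)
    have "resolvent_pencil A (of_real z) \<in> carrier_mat n n" using A by simp
    with elim show ?case
      by (auto simp: R_def invertible_mat_def inverts_mat_def)
  qed
  have X: "\<forall>\<^sub>F z in at_top. \<forall>i<n. of_real z * X z $$ (i, j) =
      of_real (B $$ (i, j)) + (\<Sum>l<n. of_real (A $$ (i, l)) * X z $$ (l, j))"
    using R
  proof eventually_elim
    case (elim z)
    have Xc: "X z \<in> carrier_mat n nu" using elim B by (auto simp: X_def)
    have "resolvent_pencil A (of_real z) * X z =
        (resolvent_pencil A (of_real z) * R z) * map_mat complex_of_real B"
      unfolding X_def using elim B A
      by (intro assoc_mult_mat[symmetric, of _ n n _ n _ nu]) auto
    also have "\<dots> = map_mat complex_of_real B" using elim B by simp
    finally show ?case
      using resolvent_pencil_mult_index[OF A Xc _ j, of _ "of_real z"] B j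
      by (auto simp: algebra_simps)
  qed
  show thesis
  proof (rule that[of \<phi>])
    fix k
    have lim: "((\<lambda>z. X z $$ (i, j)) \<longlongrightarrow> 0) at_top" if "i < n" for i
      using resolvent_solution_tendsto_0[where v = "\<lambda>z i. X z $$ (i, j)", OF X that] .
    have "((\<lambda>z. \<phi> k z) \<longlongrightarrow> (\<Sum>i<n. of_real (w k $ i) * 0)) at_top"
      unfolding \<phi>_def by (intro tendsto_sum tendsto_mult_left lim) simp
    then show "(\<phi> k \<longlongrightarrow> 0) at_top" by simp
    have wSuc: "w (Suc k) $ l = (\<Sum>i<n. A $$ (i, l) * w k $ i)" if "l < n" for l
      using A w[of k] that
      by (simp add: w_def costate_Suc scalar_prod_def atLeast0LessThan)
    have BT: "(B\<^sup>T *\<^sub>v w k) $ j = (\<Sum>i<n. B $$ (i, j) * w k $ i)"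
      using B w[of k] j by (simp add: scalar_prod_def atLeast0LessThan)
    show "\<forall>\<^sub>F z in at_top. of_real z * \<phi> k z =
       of_real ((B\<^sup>T *\<^sub>v costate A k (C\<^sup>T *\<^sub>v b)) $ j) + \<phi> (Suc k) z"
      using X
    proof eventually_elim
      case (elim z)
      have "of_real z * \<phi> k z = (\<Sum>i<n. of_real (w k $ i) * (of_real z * X z $$ (i, j)))"
        by (simp add: \<phi>_def sum_distrib_left algebra_simps)
      also have "\<dots> = (\<Sum>i<n. of_real (w k $ i) * of_real (B $$ (i, j)) +
          (\<Sum>l<n. of_real (A $$ (i, l) * w k $ i) * X z $$ (l, j)))"
        using elim by (intro sum.cong refl) (simp add: algebra_simps sum_distrib_left)
      also have "\<dots> = of_real ((B\<^sup>T *\<^sub>v w k) $ j) +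
          (\<Sum>l<n. \<Sum>i<n. of_real (A $$ (i, l) * w k $ i) * X z $$ (l, j))"
        by (subst sum.swap) (simp add: sum.distrib BT mult.commute)
      also have "(\<Sum>l<n. \<Sum>i<n. of_real (A $$ (i, l) * w k $ i) * X z $$ (l, j)) = \<phi> (Suc k) z"
        by (simp add: \<phi>_def wSuc sum_distrib_right)
      finally show ?case by (simp add: w_def)
    qed
  next
    show "\<forall>\<^sub>F z in at_top. invertible_mat (resolvent_pencil A (of_real z)) \<and>
       (\<Sum>p<ny. of_real (b $ p) * transfer_function A B C D (of_real z) $$ (p, j)) =
       of_real (\<Sum>p<ny. b $ p * D $$ (p, j)) + \<phi> 0 z"
      using R
    proof eventually_elim
      case (elim z)
      have Xc: "X z \<in> carrier_mat n nu" using elim B by (auto simp: X_def)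
      have "map_mat complex_of_real C * R z * map_mat complex_of_real B =
          map_mat complex_of_real C * X z"
        unfolding X_def using elim B C by (intro assoc_mult_mat[of _ ny n _ n _ nu]) auto
      then have tf: "transfer_function A B C D (of_real z) =
          map_mat complex_of_real D + map_mat complex_of_real C * X z"
        by (simp add: transfer_function_def R_def)
      have G: "transfer_function A B C D (of_real z) $$ (p, j) =
          of_real (D $$ (p, j)) + (\<Sum>i<n. of_real (C $$ (p, i)) * X z $$ (i, j))" if "p < ny" for p
        using that Xc C D j unfolding tf by (simp add: scalar_prod_def atLeast0LessThan)
      have w0: "w 0 $ i = (\<Sum>p<ny. C $$ (p, i) * b $ p)" if "i < n" for i
        using C b that by (simp add: w_def scalar_prod_def atLeast0LessThan)
      have "(\<Sum>p<ny. of_real (b $ p) * transfer_function A B C D (of_real z) $$ (p, j)) =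
          of_real (\<Sum>p<ny. b $ p * D $$ (p, j)) +
          (\<Sum>p<ny. \<Sum>i<n. of_real (b $ p) * (of_real (C $$ (p, i)) * X z $$ (i, j)))"
        by (simp add: G sum.distrib algebra_simps sum_distrib_left)
      also have "(\<Sum>p<ny. \<Sum>i<n. of_real (b $ p) * (of_real (C $$ (p, i)) * X z $$ (i, j))) = \<phi> 0 z"
        by (subst sum.swap) (simp add: \<phi>_def w0 sum_distrib_left algebra_simps)
      finally show ?case using elim by simp
    qed
  qed
qed

text \<open>
  Both sides are a transposed Markov parameter \<open>(C A ^ k B)\<^sup>T\<close> applied to \<open>b\<close>; Markov parameters are
  the coefficients of the transfer function at infinity, so they depend on it alone.
\<close>

lemma markov_parameters_eq:
  assumes sys: "lti_system n nu ny A B C D" and sys': "lti_system n' nu ny A' B' C' D'"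
    and same: "same_transfer_function A B C D A' B' C' D'"
    and b: "b \<in> carrier_vec ny"
  shows "B\<^sup>T *\<^sub>v costate A k (C\<^sup>T *\<^sub>v b) = B'\<^sup>T *\<^sub>v costate A' k (C'\<^sup>T *\<^sub>v b)"
proof (rule eq_vecI)
  show "dim_vec (B\<^sup>T *\<^sub>v costate A k (C\<^sup>T *\<^sub>v b)) = dim_vec (B'\<^sup>T *\<^sub>v costate A' k (C'\<^sup>T *\<^sub>v b))"
    using sys sys' by (auto simp: lti_system_def)
  fix j assume "j < dim_vec (B'\<^sup>T *\<^sub>v costate A' k (C'\<^sup>T *\<^sub>v b))"
  then have j: "j < nu" using sys' by (auto simp: lti_system_def)
  let ?h = "\<lambda>k. (B\<^sup>T *\<^sub>v costate A k (C\<^sup>T *\<^sub>v b)) $ j"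
  let ?h' = "\<lambda>k. (B'\<^sup>T *\<^sub>v costate A' k (C'\<^sup>T *\<^sub>v b)) $ j"
  obtain \<phi> where \<phi>: "\<And>k. (\<phi> k \<longlongrightarrow> 0) at_top"
    "\<And>k. \<forall>\<^sub>F z in at_top. of_real z * \<phi> k z = of_real (?h k) + \<phi> (Suc k) z"
    "\<forall>\<^sub>F z in at_top. invertible_mat (resolvent_pencil A (of_real z)) \<and>
       (\<Sum>p<ny. of_real (b $ p) * transfer_function A B C D (of_real z) $$ (p, j)) =
       of_real (\<Sum>p<ny. b $ p * D $$ (p, j)) + \<phi> 0 z"
    by (rule transfer_function_expansion[OF sys b j]) (rule that; assumption)
  obtain \<psi> where \<psi>: "\<And>k. (\<psi> k \<longlongrightarrow> 0) at_top"
    "\<And>k. \<forall>\<^sub>F z in at_top. of_real z * \<psi> k z = of_real (?h' k) + \<psi> (Suc k) z"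
    "\<forall>\<^sub>F z in at_top. invertible_mat (resolvent_pencil A' (of_real z)) \<and>
       (\<Sum>p<ny. of_real (b $ p) * transfer_function A' B' C' D' (of_real z) $$ (p, j)) =
       of_real (\<Sum>p<ny. b $ p * D' $$ (p, j)) + \<psi> 0 z"
    by (rule transfer_function_expansion[OF sys' b j]) (rule that; assumption)
  have "\<forall>\<^sub>F z in at_top. \<phi> 0 z - \<psi> 0 z =
      of_real (\<Sum>p<ny. b $ p * D' $$ (p, j)) - of_real (\<Sum>p<ny. b $ p * D $$ (p, j))"
    using \<phi>(3) \<psi>(3)
  proof eventually_elim
    case (elim z)
    then have "transfer_function A B C D (of_real z) = transfer_function A' B' C' D' (of_real z)"
      using same by (auto simp: same_transfer_function_def)
    with elim show ?case by (simp add: algebra_simps)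
  qed
  then have "complex_of_real (?h k) = of_real (?h' k)"
    by (rule asymptotic_coefficients_unique[where \<phi> = \<phi> and \<psi> = \<psi>
          and M = "\<lambda>k. of_real (?h k)" and M' = "\<lambda>k. of_real (?h' k)",
          OF \<phi>(1) \<psi>(1) \<phi>(2) \<psi>(2)])
  then show "?h k = ?h' k" by simp
qed

lemma mcmillan_degree_realization:
  assumes "lti_system n nu ny A B C D"
  obtains A' B' C' D' where "lti_system (mcmillan_degree A B C D) nu ny A' B' C' D'"
    "same_transfer_function A B C D A' B' C' D'"
proof -
  let ?P = "\<lambda>m. \<exists>A' B' C' D'. lti_system m (dim_col B) (dim_row C) A' B' C' D' \<and>
                 same_transfer_function A B C D A' B' C' D'"
  have dims: "dim_col B = nu" "dim_row C = ny" using assms by (auto simp: lti_system_def)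
  have "?P n" using assms unfolding dims
    by (intro exI[of _ A] exI[of _ B] exI[of _ C] exI[of _ D]) (simp add: same_transfer_function_def)
  then have "?P (mcmillan_degree A B C D)"
    unfolding mcmillan_degree_def by (rule LeastI)
  with that dims show thesis by auto
qed

section \<open>Stacked signals and the linearity of the external behavior\<close>

lemma stack_carrier [simp]: "stack q L w \<in> carrier_vec (L * q)"
  by (simp add: stack_def)

lemma dim_vec_stack [simp]: "dim_vec (stack q L w) = L * q"
  by (simp add: stack_def)

lemma stack_cong: "(\<And>t. t < L \<Longrightarrow> f t = g t) \<Longrightarrow> stack q L f = stack q L g"
  unfolding stack_def by (intro eq_vecI) (auto simp: less_mult_imp_div_less)

lemma block_index_less:
  fixes t s q L :: nat
  assumes "t < L" "s < q"
  shows "t * q + s < L * q"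
proof -
  have "t * q + s < Suc t * q" using assms(2) by simp
  also have "\<dots> \<le> L * q" using assms(1) by (intro mult_le_mono1) simp
  finally show ?thesis .
qed

lemma stack_index_block:
  assumes "t < L" "s < q"
  shows "stack q L f $ (t * q + s) = f t $ s"
proof -
  have "t * q + s < L * q"
    using block_index_less[OF assms(1,2)] .
  then show ?thesis using assms by (simp add: stack_def)
qed

lemma stack_scalar_prod:
  assumes "\<And>t. t < L \<Longrightarrow> f t \<in> carrier_vec q" "\<And>t. t < L \<Longrightarrow> g t \<in> carrier_vec q"
  shows "stack q L f \<bullet> stack q L g = (\<Sum>t<L. f t \<bullet> g t)"
proof -
  have "stack q L f \<bullet> stack q L g = (\<Sum>i<L * q. stack q L f $ i * stack q L g $ i)"
    by (simp add: scalar_prod_def atLeast0LessThan)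
  also have "\<dots> = (\<Sum>t<L. \<Sum>i\<in>{0 + t * q..<q + t * q}. stack q L f $ i * stack q L g $ i)"
    by (simp add: sum.nat_group[symmetric] add.commute)
  also have "\<dots> = (\<Sum>t<L. f t \<bullet> g t)"
  proof (intro sum.cong refl)
    fix t assume t: "t \<in> {..<L}"
    have "(\<Sum>i\<in>{0 + t * q..<q + t * q}. stack q L f $ i * stack q L g $ i) =
        (\<Sum>s\<in>{0..<q}. stack q L f $ (t * q + s) * stack q L g $ (t * q + s))"
      unfolding sum.shift_bounds_nat_ivl by (simp add: add.commute)
    also have "\<dots> = (\<Sum>s\<in>{0..<q}. f t $ s * g t $ s)"
      using t by (intro sum.cong refl) (simp add: stack_index_block)
    also have "\<dots> = f t \<bullet> g t" using t carrier_vecD[OF assms(2)] by (simp add: scalar_prod_def)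
    finally show "(\<Sum>i\<in>{0 + t * q..<q + t * q}. stack q L f $ i * stack q L g $ i) = f t \<bullet> g t" .
  qed
  finally show ?thesis .
qed

text \<open>
  Used to read a functional on stacked external signals as weights on the individual inputs and
  outputs.
\<close>

lemma stack_surj:
  assumes "r \<in> carrier_vec (L * (nu + ny))"
  obtains a b where "\<And>t. a t \<in> carrier_vec nu" "\<And>t. b t \<in> carrier_vec ny"
    "r = stack (nu + ny) L (\<lambda>t. a t @\<^sub>v b t)"
proof -
  define a where "a t = Matrix.vec nu (\<lambda>s. r $ (t * (nu + ny) + s))" for t
  define b where "b t = Matrix.vec ny (\<lambda>s. r $ (t * (nu + ny) + (nu + s)))" for t
  show thesis
  proof (rule that[of a b])
    show "r = stack (nu + ny) L (\<lambda>t. a t @\<^sub>v b t)"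
    proof (rule eq_vecI)
      fix i assume "i < dim_vec (stack (nu + ny) L (\<lambda>t. a t @\<^sub>v b t))"
      then have i: "i < L * (nu + ny)" by (simp add: stack_def)
      define t s where "t = i div (nu + ny)" and "s = i mod (nu + ny)"
      have "0 < nu + ny" using i by (metis gr0I mult_0_right not_less0)
      then have s: "s < nu + ny" and t: "t < L"
        using i by (simp_all add: s_def t_def less_mult_imp_div_less)
      have its: "i = t * (nu + ny) + s"
        unfolding s_def t_def by (rule div_mult_mod_eq[symmetric])
      show "r $ i = stack (nu + ny) L (\<lambda>t. a t @\<^sub>v b t) $ i"
        unfolding its stack_index_block[OF t s] using s by (auto simp: a_def b_def not_less)
    qed (use assms in \<open>simp add: stack_def\<close>)
  qed (auto simp: a_def b_def)
qed

lemma hankel_carrier [simp]: "hankel q L N w \<in> carrier_mat (L * q) (N + 1 - L)"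
  by (auto simp: hankel_def simp del: mat_of_cols_map intro!: carrier_matI)

lemma col_hankel:
  assumes "j < N + 1 - L"
  shows "col (hankel q L N w) j = stack q L (\<lambda>t. w (j + t))"
  using assms unfolding hankel_def by (subst col_mat_of_cols) (auto simp del: mat_of_cols_map)

text \<open>
  Full row rank of the input Hankel matrix is used in this form only: a linear relation that
  holds between the inputs of every window of length \<open>K\<close> is trivial.
\<close>

lemma persistently_exciting_annihilator:
  assumes pe: "persistently_exciting nu K N u"
    and u: "\<And>t. t < N \<Longrightarrow> u t \<in> carrier_vec nu" and g: "\<And>s. s < K \<Longrightarrow> g s \<in> carrier_vec nu"
    and ann: "\<And>j. j + K \<le> N \<Longrightarrow> (\<Sum>s<K. g s \<bullet> u (j + s)) = 0"
    and s: "s < K"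
  shows "g s = 0\<^sub>v nu"
proof -
  have "stack nu K g = 0\<^sub>v (K * nu)"
  proof (rule full_row_rank_left_kernel[OF hankel_carrier])
    show "vec_space.rank (K * nu) (hankel nu K N u) = K * nu"
      using pe by (simp add: persistently_exciting_def)
    fix j assume j: "j < N + 1 - K"
    then show "stack nu K g \<bullet> col (hankel nu K N u) j = 0"
      using ann[of j] u g by (simp add: col_hankel stack_scalar_prod)
  qed simp
  then have "g s $ i = 0" if "i < nu" for i
    using stack_index_block[OF s that, of g] block_index_less[OF s that] by simp
  then show ?thesis using g[OF s] by (intro eq_vecI) auto
qed

lemma lti_trajectory_state_carrier:
  assumes "lti_system nx nu ny A B C D" "lti_trajectory A B C D T x u y" "t \<le> T"
  shows "x t \<in> carrier_vec nx"
  using assms(3)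
proof (induction t)
  case 0
  then show ?case using assms by (auto simp: lti_system_def lti_trajectory_def)
next
  case (Suc t)
  then show ?case using assms(1,2) by (auto simp: lti_system_def lti_trajectory_def)
qed

lemma lti_trajectory_signal_carrier:
  assumes "lti_system nx nu ny A B C D" "lti_trajectory A B C D T x u y" "t < T"
  shows "u t \<in> carrier_vec nu" "y t \<in> carrier_vec ny"
proof -
  have "x t \<in> carrier_vec nx" using lti_trajectory_state_carrier assms by simp
  moreover have "u t \<in> carrier_vec (dim_col B)" "y t = C *\<^sub>v x t + D *\<^sub>v u t"
    using assms by (auto simp: lti_trajectory_def)
  ultimately show "u t \<in> carrier_vec nu" "y t \<in> carrier_vec ny"
    using assms(1) by (auto simp: lti_system_def intro!: add_carrier_vec mult_mat_vec_carrier)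
qed

lemma lti_trajectory_window:
  assumes "lti_system nx nu ny A B C D" "lti_trajectory A B C D T x u y" "j + L \<le> T"
  shows "lti_trajectory A B C D L (\<lambda>t. x (j + t)) (\<lambda>t. u (j + t)) (\<lambda>t. y (j + t))"
  using assms lti_trajectory_state_carrier[OF assms(1,2), of j]
  by (auto simp: lti_trajectory_def lti_system_def)

lemma lti_trajectory_add:
  assumes sys: "lti_system nx nu ny A B C D"
    and "lti_trajectory A B C D T x u y" "lti_trajectory A B C D T x' u' y'"
  shows "lti_trajectory A B C D T (\<lambda>t. x t + x' t) (\<lambda>t. u t + u' t) (\<lambda>t. y t + y' t)"
proof -
  have car: "A \<in> carrier_mat nx nx" "B \<in> carrier_mat nx nu" "C \<in> carrier_mat ny nx" "D \<in> carrier_mat ny nu"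
    using sys by (auto simp: lti_system_def)
  show ?thesis
    unfolding lti_trajectory_def
  proof (intro conjI allI impI)
    show "x 0 + x' 0 \<in> carrier_vec (dim_row A)" using assms by (auto simp: lti_trajectory_def)
    fix t assume t: "t < T"
    note [simp] = lti_trajectory_state_carrier[OF sys assms(2) less_imp_le[OF t]]
      lti_trajectory_state_carrier[OF sys assms(3) less_imp_le[OF t]]
      lti_trajectory_signal_carrier[OF sys assms(2) t] lti_trajectory_signal_carrier[OF sys assms(3) t]
    have [simp]: "A *\<^sub>v x t \<in> carrier_vec nx" "A *\<^sub>v x' t \<in> carrier_vec nx"
      "B *\<^sub>v u t \<in> carrier_vec nx" "B *\<^sub>v u' t \<in> carrier_vec nx"
      "C *\<^sub>v x t \<in> carrier_vec ny" "C *\<^sub>v x' t \<in> carrier_vec ny"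
      "D *\<^sub>v u t \<in> carrier_vec ny" "D *\<^sub>v u' t \<in> carrier_vec ny"
      using car by (auto intro!: mult_mat_vec_carrier)
    note lin = mult_add_distrib_mat_vec[OF car(1), of "x t" "x' t"] mult_add_distrib_mat_vec[OF car(2), of "u t" "u' t"]
      mult_add_distrib_mat_vec[OF car(3), of "x t" "x' t"] mult_add_distrib_mat_vec[OF car(4), of "u t" "u' t"]
    show "u t + u' t \<in> carrier_vec (dim_col B)" using car by simp
    show "x (Suc t) + x' (Suc t) = A *\<^sub>v (x t + x' t) + B *\<^sub>v (u t + u' t)"
      using assms(2,3) t car unfolding lti_trajectory_def
      by (simp add: lin) (auto intro!: eq_vecI)
    show "y t + y' t = C *\<^sub>v (x t + x' t) + D *\<^sub>v (u t + u' t)"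
      using assms(2,3) t car unfolding lti_trajectory_def
      by (simp add: lin) (auto intro!: eq_vecI)
  qed
qed

lemma lti_trajectory_smult:
  assumes sys: "lti_system nx nu ny A B C D"
    and "lti_trajectory A B C D T x u y"
  shows "lti_trajectory A B C D T (\<lambda>t. a \<cdot>\<^sub>v x t) (\<lambda>t. a \<cdot>\<^sub>v u t) (\<lambda>t. a \<cdot>\<^sub>v y t)"
proof -
  have car: "A \<in> carrier_mat nx nx" "B \<in> carrier_mat nx nu" "C \<in> carrier_mat ny nx" "D \<in> carrier_mat ny nu"
    using sys by (auto simp: lti_system_def)
  show ?thesis
    unfolding lti_trajectory_def
  proof (intro conjI allI impI)
    show "a \<cdot>\<^sub>v x 0 \<in> carrier_vec (dim_row A)" using assms by (auto simp: lti_trajectory_def)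
    fix t assume t: "t < T"
    note [simp] = lti_trajectory_state_carrier[OF sys assms(2) less_imp_le[OF t]]
      lti_trajectory_signal_carrier[OF sys assms(2) t]
    have [simp]: "A *\<^sub>v x t \<in> carrier_vec nx" "B *\<^sub>v u t \<in> carrier_vec nx"
      "C *\<^sub>v x t \<in> carrier_vec ny" "D *\<^sub>v u t \<in> carrier_vec ny"
      using car by (auto intro!: mult_mat_vec_carrier)
    note lin = mult_mat_vec[OF car(1), of "x t"] mult_mat_vec[OF car(2), of "u t"]
      mult_mat_vec[OF car(3), of "x t"] mult_mat_vec[OF car(4), of "u t"]
    show "a \<cdot>\<^sub>v u t \<in> carrier_vec (dim_col B)" using car by simp
    show "a \<cdot>\<^sub>v x (Suc t) = A *\<^sub>v (a \<cdot>\<^sub>v x t) + B *\<^sub>v (a \<cdot>\<^sub>v u t)"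
      using assms(2) t car unfolding lti_trajectory_def
      by (simp add: lin smult_add_distrib_vec[of _ nx])
    show "a \<cdot>\<^sub>v y t = C *\<^sub>v (a \<cdot>\<^sub>v x t) + D *\<^sub>v (a \<cdot>\<^sub>v u t)"
      using assms(2) t car unfolding lti_trajectory_def
      by (simp add: lin smult_add_distrib_vec[of _ ny])
  qed
qed

lemma external_behavior_iff:
  assumes "lti_system nx nu ny A B C D"
  shows "w \<in> external_behavior A B C D L \<longleftrightarrow>
    (\<exists>x u y. lti_trajectory A B C D L x u y \<and> w = stack (nu + ny) L (\<lambda>t. u t @\<^sub>v y t))"
proof -
  have dims: "dim_col B = nu" "dim_row C = ny" using assms by (auto simp: lti_system_def)
  show ?thesis unfolding external_behavior_def dims by blast
qed

lemma external_behavior_carrier: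
  assumes "lti_system nx nu ny A B C D"
  shows "external_behavior A B C D L \<subseteq> carrier_vec (L * (nu + ny))"
  using external_behavior_iff[OF assms] by auto

lemma external_behavior_add:
  assumes sys: "lti_system nx nu ny A B C D"
    and "v \<in> external_behavior A B C D L" "w \<in> external_behavior A B C D L"
  shows "v + w \<in> external_behavior A B C D L"
proof -
  obtain x u y where 1: "lti_trajectory A B C D L x u y" "v = stack (nu + ny) L (\<lambda>t. u t @\<^sub>v y t)"
    using assms external_behavior_iff[OF sys] by blast
  obtain x' u' y' where 2: "lti_trajectory A B C D L x' u' y'" "w = stack (nu + ny) L (\<lambda>t. u' t @\<^sub>v y' t)"
    using assms external_behavior_iff[OF sys] by blast
  have "v + w = stack (nu + ny) L (\<lambda>t. (u t @\<^sub>v y t) + (u' t @\<^sub>v y' t))"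
  proof (rule eq_vecI)
    fix i assume "i < dim_vec (stack (nu + ny) L (\<lambda>t. (u t @\<^sub>v y t) + (u' t @\<^sub>v y' t)))"
    then have i: "i < L * (nu + ny)" by (simp add: stack_def)
    then have t: "i div (nu + ny) < L" and "0 < nu + ny"
      by (auto simp: less_mult_imp_div_less intro: Nat.gr0I)
    then have "i mod (nu + ny) < nu + ny" by simp
    then show "(v + w) $ i = stack (nu + ny) L (\<lambda>t. (u t @\<^sub>v y t) + (u' t @\<^sub>v y' t)) $ i"
      using i lti_trajectory_signal_carrier[OF sys 2(1) t] by (simp add: 1 2 stack_def)
  qed (simp add: 1 2 stack_def)
  also have "\<dots> = stack (nu + ny) L (\<lambda>t. (u t + u' t) @\<^sub>v (y t + y' t))"
    using lti_trajectory_signal_carrier[OF sys 1(1)] lti_trajectory_signal_carrier[OF sys 2(1)]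
    by (intro stack_cong append_vec_add) auto
  finally show ?thesis
    using lti_trajectory_add[OF sys 1(1) 2(1)] external_behavior_iff[OF sys] by blast
qed

lemma external_behavior_smult:
  assumes sys: "lti_system nx nu ny A B C D" and "v \<in> external_behavior A B C D L"
  shows "a \<cdot>\<^sub>v v \<in> external_behavior A B C D L"
proof -
  obtain x u y where 1: "lti_trajectory A B C D L x u y" "v = stack (nu + ny) L (\<lambda>t. u t @\<^sub>v y t)"
    using assms external_behavior_iff[OF sys] by blast
  have "a \<cdot>\<^sub>v v = stack (nu + ny) L (\<lambda>t. (a \<cdot>\<^sub>v u t) @\<^sub>v (a \<cdot>\<^sub>v y t))"
  proof (rule eq_vecI)
    fix i assume "i < dim_vec (stack (nu + ny) L (\<lambda>t. (a \<cdot>\<^sub>v u t) @\<^sub>v (a \<cdot>\<^sub>v y t)))"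
    then have i: "i < L * (nu + ny)" by (simp add: stack_def)
    then have t: "i div (nu + ny) < L" and "0 < nu + ny"
      by (auto simp: less_mult_imp_div_less intro: Nat.gr0I)
    then have "i mod (nu + ny) < nu + ny" by simp
    then show "(a \<cdot>\<^sub>v v) $ i = stack (nu + ny) L (\<lambda>t. (a \<cdot>\<^sub>v u t) @\<^sub>v (a \<cdot>\<^sub>v y t)) $ i"
      using i lti_trajectory_signal_carrier[OF sys 1(1) t] by (simp add: 1 stack_def)
  qed (simp add: 1 stack_def)
  then show ?thesis
    using lti_trajectory_smult[OF sys 1(1)] external_behavior_iff[OF sys] by blast
qed

text \<open>
  This is the response to zero initial state and input. Writing it as a multiple by zero of that
  response avoids evaluating the stacked vector.
\<close>

lemma zero_in_external_behavior:
  assumes sys: "lti_system nx nu ny A B C D"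
  shows "0\<^sub>v (L * (nu + ny)) \<in> external_behavior A B C D L"
proof -
  have "lti_trajectory A B C D L (\<lambda>t. 0\<^sub>v nx) (\<lambda>t. 0\<^sub>v nu) (\<lambda>t. 0\<^sub>v ny)"
    using sys by (auto simp: lti_trajectory_def lti_system_def)
  then have "stack (nu + ny) L (\<lambda>t. 0\<^sub>v nu @\<^sub>v 0\<^sub>v ny) \<in> external_behavior A B C D L"
    using external_behavior_iff[OF sys] by blast
  then have "0 \<cdot>\<^sub>v stack (nu + ny) L (\<lambda>t. 0\<^sub>v nu @\<^sub>v 0\<^sub>v ny) \<in> external_behavior A B C D L"
    by (rule external_behavior_smult[OF sys])
  also have "0 \<cdot>\<^sub>v stack (nu + ny) L (\<lambda>t. 0\<^sub>v nu @\<^sub>v 0\<^sub>v ny) = 0\<^sub>v (L * (nu + ny))"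
    by (intro eq_vecI) (auto simp: stack_def)
  finally show ?thesis .
qed

section \<open>The fundamental lemma\<close>

text \<open>
  The vector \<open>\<Sum>t<L. (A\<^sup>T) ^ t C\<^sup>T b t\<close>, which pairs with the initial state as the weights \<open>b\<close> pair
  with the free response; the recursion runs the adjoint system backwards from time \<open>L\<close>.
\<close>

primrec adjoint_state :: "real mat \<Rightarrow> real mat \<Rightarrow> nat \<Rightarrow> (nat \<Rightarrow> rvec) \<Rightarrow> rvec" where
  "adjoint_state A C 0 b = 0\<^sub>v (dim_row A)"
| "adjoint_state A C (Suc L) b = C\<^sup>T *\<^sub>v b 0 + A\<^sup>T *\<^sub>v adjoint_state A C L (\<lambda>t. b (Suc t))"

lemma adjoint_state_carrier [simp]:
  assumes "A \<in> carrier_mat nx nx" "C \<in> carrier_mat ny nx" "\<And>t. b t \<in> carrier_vec ny"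
  shows "adjoint_state A C L b \<in> carrier_vec nx"
  using assms(3)
proof (induction L arbitrary: b)
  case (Suc L)
  show ?case
    using assms(1,2) Suc.prems Suc.IH[of "\<lambda>t. b (Suc t)"]
    by (auto intro!: add_carrier_vec mult_mat_vec_carrier)
qed (use assms in auto)

text \<open>
  Eliminating outputs: along trajectories a functional of the external signal is a functional of
  the initial state and of the inputs. Peeling off the first sample and substituting the state
  equation turns the functional of \<open>x 1\<close> into one of \<open>x 0\<close> and \<open>u 0\<close>.
\<close>

lemma external_functional_along_trajectory:
  assumes sys: "lti_system nx nu ny A B C D"
    and "\<And>t. a t \<in> carrier_vec nu" "\<And>t. b t \<in> carrier_vec ny"
  shows "\<exists>\<alpha>. (\<forall>t. \<alpha> t \<in> carrier_vec nu) \<and>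
    (\<forall>x u y. lti_trajectory A B C D L x u y \<longrightarrow>
      (\<Sum>t<L. a t \<bullet> u t + b t \<bullet> y t) = adjoint_state A C L b \<bullet> x 0 + (\<Sum>t<L. \<alpha> t \<bullet> u t))"
  using assms(2,3)
proof (induction L arbitrary: a b)
  case 0
  have "adjoint_state A C 0 b \<bullet> x 0 = 0" if "lti_trajectory A B C D 0 x u y" for x u y
    using that by (auto simp: lti_trajectory_def)
  then show ?case by (intro exI[of _ "\<lambda>_. 0\<^sub>v nu"]) auto
next
  case (Suc L)
  have car: "A \<in> carrier_mat nx nx" "B \<in> carrier_mat nx nu" "C \<in> carrier_mat ny nx" "D \<in> carrier_mat ny nu"
    using sys by (auto simp: lti_system_def)
  define \<eta> where "\<eta> = adjoint_state A C L (\<lambda>t. b (Suc t))"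
  have \<eta>: "\<eta> \<in> carrier_vec nx" unfolding \<eta>_def using car Suc.prems by (intro adjoint_state_carrier) auto
  obtain \<alpha> where \<alpha>: "\<And>t. \<alpha> t \<in> carrier_vec nu" and IH: "\<And>x u y. lti_trajectory A B C D L x u y \<Longrightarrow>
      (\<Sum>t<L. a (Suc t) \<bullet> u t + b (Suc t) \<bullet> y t) = \<eta> \<bullet> x 0 + (\<Sum>t<L. \<alpha> t \<bullet> u t)"
    using Suc.IH[of "\<lambda>t. a (Suc t)" "\<lambda>t. b (Suc t)"] Suc.prems unfolding \<eta>_def by blast
  define \<beta> where "\<beta> t = (case t of 0 \<Rightarrow> a 0 + (D\<^sup>T *\<^sub>v b 0 + B\<^sup>T *\<^sub>v \<eta>) | Suc t \<Rightarrow> \<alpha> t)" for t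
  have tr: "C\<^sup>T *\<^sub>v b 0 \<in> carrier_vec nx" "D\<^sup>T *\<^sub>v b 0 \<in> carrier_vec nu"
    "A\<^sup>T *\<^sub>v \<eta> \<in> carrier_vec nx" "B\<^sup>T *\<^sub>v \<eta> \<in> carrier_vec nu"
    using car \<eta> Suc.prems by (auto intro!: mult_mat_vec_carrier)
  have \<beta>: "\<beta> t \<in> carrier_vec nu" for t
    using tr Suc.prems \<alpha> by (auto simp: \<beta>_def split: nat.split)
  have "(\<Sum>t<Suc L. a t \<bullet> u t + b t \<bullet> y t) =
      adjoint_state A C (Suc L) b \<bullet> x 0 + (\<Sum>t<Suc L. \<beta> t \<bullet> u t)"
    if T: "lti_trajectory A B C D (Suc L) x u y" for x u y
  proof -
    have x0: "x 0 \<in> carrier_vec nx" and u0: "u 0 \<in> carrier_vec nu"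
      using lti_trajectory_state_carrier[OF sys T, of 0] lti_trajectory_signal_carrier[OF sys T, of 0] by auto
    have x1: "x 1 = A *\<^sub>v x 0 + B *\<^sub>v u 0" and y0: "y 0 = C *\<^sub>v x 0 + D *\<^sub>v u 0"
      using T by (auto simp: lti_trajectory_def)
    have mv: "A *\<^sub>v x 0 \<in> carrier_vec nx" "B *\<^sub>v u 0 \<in> carrier_vec nx"
      "C *\<^sub>v x 0 \<in> carrier_vec ny" "D *\<^sub>v u 0 \<in> carrier_vec ny"
      using car x0 u0 by (auto intro!: mult_mat_vec_carrier)
    have "lti_trajectory A B C D L (\<lambda>t. x (1 + t)) (\<lambda>t. u (1 + t)) (\<lambda>t. y (1 + t))"
      by (rule lti_trajectory_window[OF sys T]) simp
    from IH[OF this] have tail: "(\<Sum>t<L. a (Suc t) \<bullet> u (Suc t) + b (Suc t) \<bullet> y (Suc t)) =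
        \<eta> \<bullet> x 1 + (\<Sum>t<L. \<alpha> t \<bullet> u (Suc t))" by simp
    have yb: "b 0 \<bullet> y 0 = (C\<^sup>T *\<^sub>v b 0) \<bullet> x 0 + (D\<^sup>T *\<^sub>v b 0) \<bullet> u 0"
      unfolding y0 scalar_prod_add_distrib[OF Suc.prems(2) mv(3,4)]
      using transpose_vec_mult_scalar[OF car(3) x0 Suc.prems(2)]
        transpose_vec_mult_scalar[OF car(4) u0 Suc.prems(2)] by simp
    have xe: "\<eta> \<bullet> x 1 = (A\<^sup>T *\<^sub>v \<eta>) \<bullet> x 0 + (B\<^sup>T *\<^sub>v \<eta>) \<bullet> u 0"
      unfolding x1 scalar_prod_add_distrib[OF \<eta> mv(1,2)]
      using transpose_vec_mult_scalar[OF car(1) x0 \<eta>] transpose_vec_mult_scalar[OF car(2) u0 \<eta>] by simp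
    have "adjoint_state A C (Suc L) b \<bullet> x 0 = (C\<^sup>T *\<^sub>v b 0) \<bullet> x 0 + (A\<^sup>T *\<^sub>v \<eta>) \<bullet> x 0"
      using add_scalar_prod_distrib[OF tr(1,3) x0] by (simp add: \<eta>_def)
    moreover have "\<beta> 0 \<bullet> u 0 = a 0 \<bullet> u 0 + ((D\<^sup>T *\<^sub>v b 0) \<bullet> u 0 + (B\<^sup>T *\<^sub>v \<eta>) \<bullet> u 0)"
      using add_scalar_prod_distrib[OF Suc.prems(1) add_carrier_vec[OF tr(2,4)] u0]
        add_scalar_prod_distrib[OF tr(2,4) u0] by (simp add: \<beta>_def)
    ultimately show ?thesis
      unfolding sum.lessThan_Suc_shift tail yb xe by (simp add: \<beta>_def)
  qed
  with \<beta> show ?case by blast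
qed

text \<open>
  The effect of the inputs on a state functional that comes from outputs is a combination of
  Markov parameters. This is what lets a minimal realization stand in for the given one.
\<close>

lemma markov_parameters_adjoint_state_eq:
  assumes sys: "lti_system n nu ny A B C D" and sys': "lti_system n' nu ny A' B' C' D'"
    and same: "same_transfer_function A B C D A' B' C' D'"
    and b: "\<And>t. b t \<in> carrier_vec ny"
  shows "B\<^sup>T *\<^sub>v costate A k (adjoint_state A C L b) = B'\<^sup>T *\<^sub>v costate A' k (adjoint_state A' C' L b)"
  using b
proof (induction L arbitrary: k b)
  case 0
  have zero: "B\<^sup>T *\<^sub>v costate A k (0\<^sub>v (dim_row A)) = 0\<^sub>v nu" if "lti_system n nu ny A B C D" for n A B C D
  proof -
    have A: "A \<in> carrier_mat n n" and B: "B \<in> carrier_mat n nu" using that by (auto simp: lti_system_def)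
    then have "costate A k (0\<^sub>v n) = 0\<^sub>v n" by (induction k) (auto simp: costate_Suc)
    with A B show ?thesis by auto
  qed
  show ?case using zero[OF sys] zero[OF sys'] by simp
next
  case (Suc L)
  have split: "B\<^sup>T *\<^sub>v costate A k (adjoint_state A C (Suc L) b) =
      B\<^sup>T *\<^sub>v costate A k (C\<^sup>T *\<^sub>v b 0) + B\<^sup>T *\<^sub>v costate A (Suc k) (adjoint_state A C L (\<lambda>t. b (Suc t)))"
    if "lti_system n nu ny A B C D" for n A B C D
  proof -
    have A: "A \<in> carrier_mat n n" and B: "B \<in> carrier_mat n nu" and C: "C \<in> carrier_mat ny n"
      using that by (auto simp: lti_system_def)
    have \<eta>: "adjoint_state A C L (\<lambda>t. b (Suc t)) \<in> carrier_vec n"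
      using A C Suc.prems by (intro adjoint_state_carrier) auto
    have "C\<^sup>T *\<^sub>v b 0 \<in> carrier_vec n" "A\<^sup>T *\<^sub>v adjoint_state A C L (\<lambda>t. b (Suc t)) \<in> carrier_vec n"
      using A C \<eta> Suc.prems by (auto intro!: mult_mat_vec_carrier)
    then show ?thesis
      using A B by (simp add: costate_add costate_Suc' mult_add_distrib_mat_vec[of _ nu n])
  qed
  show ?case
    unfolding split[OF sys] split[OF sys'] markov_parameters_eq[OF sys sys' same Suc.prems]
    using Suc.IH[of "\<lambda>t. b (Suc t)"] Suc.prems by simp
qed

text \<open>
  The \<open>m + 1\<close> costates \<open>(A\<^sup>T) ^ k \<eta>\<close>, \<open>k \<le> m\<close>, are linearly dependent in dimension \<open>m\<close>; dividing by the
  last nonzero coefficient gives a monic relation, which \<open>A\<^sup>T\<close> carries to all later costates.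
\<close>

lemma costate_monic_recurrence:
  assumes A: "A \<in> carrier_mat m m" and e: "\<eta> \<in> carrier_vec m"
  obtains d p where "d \<le> m" "p d = 1"
    "\<And>j x. x \<in> carrier_vec m \<Longrightarrow> (\<Sum>k\<le>d. p k * (costate A (k + j) \<eta> \<bullet> x)) = 0"
proof -
  (* Padding the costates with a zero coordinate makes the matrix square and visibly singular. *)
  define M where "M = Matrix.mat (Suc m) (Suc m) (\<lambda>(i, k). if i = m then 0 else costate A k \<eta> $ i)"
  have M: "M \<in> carrier_mat (Suc m) (Suc m)" by (simp add: M_def)
  have "M\<^sup>T *\<^sub>v unit_vec (Suc m) m = 0\<^sub>v (Suc m)"
    using M by (intro eq_vecI) (auto simp: M_def)
  moreover have "unit_vec (Suc m) m \<noteq> (0\<^sub>v (Suc m) :: rvec)"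
    by (metis index_unit_vec(1) index_zero_vec(1) lessI zero_neq_one)
  ultimately have "det (M\<^sup>T) = 0"
    using det_0_iff_vec_prod_zero[of "M\<^sup>T" "Suc m"] M by (metis transpose_carrier_mat unit_vec_carrier)
  then have "det M = 0" using det_transpose[OF M] by simp
  then obtain v where v: "v \<in> carrier_vec (Suc m)" "v \<noteq> 0\<^sub>v (Suc m)" "M *\<^sub>v v = 0\<^sub>v (Suc m)"
    using det_0_iff_vec_prod_zero[OF M] by blast
  define I where "I = {k. k \<le> m \<and> v $ k \<noteq> 0}"
  have "I \<noteq> {}"
  proof
    assume "I = {}"
    then have "v = 0\<^sub>v (Suc m)" using v(1) by (intro eq_vecI) (auto simp: I_def less_Suc_eq_le)
    with v(2) show False by simp
  qed
  define d where "d = Max I"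
  have fin: "finite I" by (simp add: I_def)
  have d: "d \<le> m" "v $ d \<noteq> 0" using Max_in[OF fin \<open>I \<noteq> {}\<close>] by (auto simp: d_def I_def)
  have above: "v $ k = 0" if "k \<le> m" "d < k" for k
  proof (rule ccontr)
    assume "v $ k \<noteq> 0"
    then have "k \<le> d" using Max_ge[OF fin, of k] that(1) by (simp add: d_def I_def)
    with that(2) show False by simp
  qed
  have col: "(\<Sum>k\<le>d. v $ k * costate A k \<eta> $ i) = 0" if i: "i < m" for i
  proof -
    have "(\<Sum>k\<le>d. v $ k * costate A k \<eta> $ i) = (\<Sum>k<Suc m. v $ k * costate A k \<eta> $ i)"
      using d(1) above by (intro sum.mono_neutral_left) auto
    also have "\<dots> = (M *\<^sub>v v) $ i"
      using i v(1) M by (simp add: M_def scalar_prod_def atLeast0LessThan mult.commute)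
    finally show ?thesis using v(3) i by simp
  qed
  have base: "(\<Sum>k\<le>d. v $ k * (costate A k \<eta> \<bullet> x)) = 0" if x: "x \<in> carrier_vec m" for x
  proof -
    have "(\<Sum>k\<le>d. v $ k * (costate A k \<eta> \<bullet> x)) = (\<Sum>k\<le>d. \<Sum>i<m. v $ k * costate A k \<eta> $ i * x $ i)"
      using x by (simp add: scalar_prod_def atLeast0LessThan sum_distrib_left mult.assoc)
    also have "\<dots> = (\<Sum>i<m. (\<Sum>k\<le>d. v $ k * costate A k \<eta> $ i) * x $ i)"
      by (subst sum.swap) (simp add: sum_distrib_right)
    also have "\<dots> = 0" using col by simp
    finally show ?thesis .
  qed
  have shift: "(\<Sum>k\<le>d. v $ k * (costate A (k + j) \<eta> \<bullet> x)) = 0" if "x \<in> carrier_vec m" for j x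
    using that
  proof (induction j arbitrary: x)
    case (Suc j)
    have "A *\<^sub>v x \<in> carrier_vec m" using A Suc.prems by (auto intro!: mult_mat_vec_carrier)
    from Suc.IH[OF this] show ?case
      using A e Suc.prems by (simp add: costate_Suc_scalar_prod)
  qed (use base in simp)
  show thesis
  proof (rule that[of d "\<lambda>k. v $ k / v $ d"])
    fix j and x :: rvec
    assume x: "x \<in> carrier_vec m"
    have "(\<Sum>k\<le>d. v $ k / v $ d * (costate A (k + j) \<eta> \<bullet> x)) =
        (\<Sum>k\<le>d. v $ k * (costate A (k + j) \<eta> \<bullet> x)) / v $ d"
      by (simp add: sum_divide_distrib)
    then show "(\<Sum>k\<le>d. v $ k / v $ d * (costate A (k + j) \<eta> \<bullet> x)) = 0"
      using shift[OF x] by simp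
  qed (use d in auto)
qed

text \<open>
  If the functionals \<open>l j\<close> do not see the input, then \<open>l 0\<close> after \<open>j\<close> steps is \<open>l j\<close> at the start;
  along any trajectory from the origin they all vanish, and controllability says that such
  trajectories reach every state.
\<close>

lemma controllable_annihilator:
  fixes l :: "nat \<Rightarrow> rvec \<Rightarrow> real"
  assumes ctrb: "controllable A B" and A: "A \<in> carrier_mat nx nx" and B: "B \<in> carrier_mat nx nu"
    and zero: "\<And>j. l j (0\<^sub>v nx) = 0"
    and step: "\<And>j x u. x \<in> carrier_vec nx \<Longrightarrow> u \<in> carrier_vec nu \<Longrightarrow> l j (A *\<^sub>v x + B *\<^sub>v u) = l (Suc j) x"
    and v: "v \<in> carrier_vec nx"
  shows "l j v = 0"
proof -
  obtain T x u where x: "x 0 = 0\<^sub>v nx" "x T = v"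
    and xu: "\<And>t. t < T \<Longrightarrow> u t \<in> carrier_vec nu \<and> x (Suc t) = A *\<^sub>v x t + B *\<^sub>v u t"
    using ctrb A B v unfolding controllable_def by (metis carrier_matD zero_carrier_vec)
  have "x t \<in> carrier_vec nx \<and> (\<forall>j. l j (x t) = 0)" if "t \<le> T" for t
    using that
  proof (induction t)
    case (Suc t)
    then have "x t \<in> carrier_vec nx" "u t \<in> carrier_vec nu" using xu by auto
    then show ?case using Suc xu[of t] A B step by (auto intro!: add_carrier_vec mult_mat_vec_carrier)
  qed (use x zero in simp)
  from this[of T] show ?thesis using x by simp
qed

text \<open>
  The product of the power series of \<open>f\<close> with the reversed polynomial is zero, and the constant
  term \<open>p d = 1\<close> makes that polynomial invertible as a power series.
\<close>

lemma monic_convolution_eq_0: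
  fixes p f :: "nat \<Rightarrow> real"
  assumes "p d = 1" and conv: "\<And>t. (\<Sum>r\<le>min d t. p (d - r) * f (t - r)) = 0"
  shows "f t = 0"
proof (induction t rule: less_induct)
  case (less t)
  have "(\<Sum>r\<le>min d t. p (d - r) * f (t - r)) = (\<Sum>r\<in>{0}. p (d - r) * f (t - r))"
    using less by (intro sum.mono_neutral_right) auto
  then show ?case using conv[of t] assms(1) by simp
qed

text \<open>
  The heart of the fundamental lemma. A relation \<open>\<eta> \<bullet> x j + (\<Sum>i<L. \<alpha> i \<bullet> u (j + i)) = 0\<close> between the state
  at the start of each window and the inputs of the window, taken at the later time \<open>j + k\<close>, becomes
  a relation between the same \<open>x j\<close> with costate \<open>(A\<^sup>T) ^ k \<eta>\<close> and \<open>L + k\<close> inputs. The combination with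
  coefficients \<open>p k\<close>, \<open>k \<le> d\<close>, has costate zero, because by the recurrence it does not see inputs and
  the system is controllable. What remains is a relation between \<open>L + d \<le> L + K\<close> consecutive inputs,
  which persistency of excitation makes trivial.

  Counted backwards from the last input, the input coefficients form one sequence \<open>F\<close> that is the
  same for all \<open>k\<close>: first \<open>\<alpha> (L - 1), \<dots>, \<alpha> 0\<close>, then \<open>B\<^sup>T (A\<^sup>T) ^ i \<eta>\<close> for \<open>i = 0, 1, \<dots>\<close>. So the trivial
  relation says that the convolution \<open>G\<close> of \<open>F\<close> with the reversed polynomial \<open>p\<close> vanishes below
  \<open>L + d\<close>, and the recurrence says that it vanishes from \<open>L + d\<close> on. As \<open>p\<close> is monic, \<open>F = 0\<close>, hence
  \<open>\<alpha> = 0\<close>, and \<open>\<eta>\<close> is orthogonal to all reachable states, hence zero.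
\<close>

lemma hankel_annihilator_vanishes:
  assumes sys: "lti_system nx nu ny A B C D" and ctrb: "controllable A B"
    and traj: "lti_trajectory A B C D N xd ud yd"
    and pe: "persistently_exciting nu (L + K) N ud"
    and \<eta>: "\<eta> \<in> carrier_vec nx" and \<alpha>: "\<And>t. \<alpha> t \<in> carrier_vec nu"
    and d: "d \<le> K" "p d = 1"
    and rec: "\<And>j v. v \<in> carrier_vec nu \<Longrightarrow> (\<Sum>k\<le>d. p k * ((B\<^sup>T *\<^sub>v costate A (k + j) \<eta>) \<bullet> v)) = 0"
    and ann: "\<And>j. j + L \<le> N \<Longrightarrow> \<eta> \<bullet> xd j + (\<Sum>i<L. \<alpha> i \<bullet> ud (j + i)) = 0"
  shows "\<eta> = 0\<^sub>v nx" and "t < L \<Longrightarrow> \<alpha> t = 0\<^sub>v nu"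
proof -
  have A: "A \<in> carrier_mat nx nx" and B: "B \<in> carrier_mat nx nu"
    using sys by (auto simp: lti_system_def)
  define e where "e k = costate A k \<eta>" for k
  define h where "h k = B\<^sup>T *\<^sub>v e k" for k
  have e: "e k \<in> carrier_vec nx" for k using A \<eta> by (simp add: e_def)
  have h: "h k \<in> carrier_vec nu" for k using B e by (auto simp: h_def intro!: mult_mat_vec_carrier)
  have e_step: "e k \<bullet> (A *\<^sub>v x + B *\<^sub>v u) = e (Suc k) \<bullet> x + h k \<bullet> u"
    if x: "x \<in> carrier_vec nx" and u: "u \<in> carrier_vec nu" for k x u
  proof -
    have "A *\<^sub>v x \<in> carrier_vec nx" "B *\<^sub>v u \<in> carrier_vec nx"
      using A B x u by (auto intro!: mult_mat_vec_carrier)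
    then have "e k \<bullet> (A *\<^sub>v x + B *\<^sub>v u) = e k \<bullet> (A *\<^sub>v x) + e k \<bullet> (B *\<^sub>v u)"
      by (rule scalar_prod_add_distrib[OF e])
    then show ?thesis
      using costate_Suc_scalar_prod[OF A \<eta> x] transpose_vec_mult_scalar[OF B u e]
      by (simp add: e_def h_def)
  qed
  define F where "F i = (if i < L then \<alpha> (L - Suc i) else h (i - L))" for i
  have F: "F i \<in> carrier_vec nu" for i using \<alpha> h by (simp add: F_def)
  have ud: "ud t \<in> carrier_vec nu" if "t < N" for t
    using lti_trajectory_signal_carrier[OF sys traj that] by simp
  have relation: "e k \<bullet> xd j + (\<Sum>i<L + k. F i \<bullet> ud (j + (L + k - Suc i))) = 0" if "j + (L + k) \<le> N" for j k
    using that
  proof (induction k arbitrary: j)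
    case 0
    have "(\<Sum>i<L. F i \<bullet> ud (j + (L - Suc i))) = (\<Sum>i<L. \<alpha> (L - Suc i) \<bullet> ud (j + (L - Suc i)))"
      by (simp add: F_def)
    also have "\<dots> = (\<Sum>i<L. \<alpha> i \<bullet> ud (j + i))"
      by (rule sum.nat_diff_reindex)
    finally show ?case using ann[of j] 0 by (simp add: e_def)
  next
    case (Suc k)
    then have j: "j < N" by simp
    have xj: "xd j \<in> carrier_vec nx" using lti_trajectory_state_carrier[OF sys traj] j by simp
    have xs: "xd (Suc j) = A *\<^sub>v xd j + B *\<^sub>v ud j" using traj j by (simp add: lti_trajectory_def)
    have "(\<Sum>i<L + k. F i \<bullet> ud (Suc j + (L + k - Suc i))) = (\<Sum>i<L + k. F i \<bullet> ud (j + (L + Suc k - Suc i)))"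
    proof (intro sum.cong refl)
      fix i assume "i \<in> {..<L + k}"
      then have "Suc j + (L + k - Suc i) = j + (L + Suc k - Suc i)" by auto
      then show "F i \<bullet> ud (Suc j + (L + k - Suc i)) = F i \<bullet> ud (j + (L + Suc k - Suc i))"
        by (simp only:)
    qed
    moreover have "F (L + k) = h k" by (simp add: F_def)
    ultimately show ?case
      using Suc.IH[of "Suc j"] Suc.prems e_step[OF xj ud[OF j], of k] by (simp add: xs)
  qed
  have e_rec: "(\<Sum>k\<le>d. p k * (e (k + j) \<bullet> x)) = 0" if x: "x \<in> carrier_vec nx" for j x
  proof (rule controllable_annihilator[OF ctrb A B, where l = "\<lambda>j x. \<Sum>k\<le>d. p k * (e (k + j) \<bullet> x)"])
    show "(\<Sum>k\<le>d. p k * (e (k + j) \<bullet> 0\<^sub>v nx)) = 0" for j using e by simp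
    fix j and x u :: rvec
    assume x: "x \<in> carrier_vec nx" and u: "u \<in> carrier_vec nu"
    have "(\<Sum>k\<le>d. p k * (e (k + j) \<bullet> (A *\<^sub>v x + B *\<^sub>v u))) =
        (\<Sum>k\<le>d. p k * (e (k + Suc j) \<bullet> x)) + (\<Sum>k\<le>d. p k * (h (k + j) \<bullet> u))"
      using e_step[OF x u] by (simp add: sum.distrib algebra_simps)
    also have "(\<Sum>k\<le>d. p k * (h (k + j) \<bullet> u)) = 0" using rec[OF u] by (simp add: h_def e_def)
    finally show "(\<Sum>k\<le>d. p k * (e (k + j) \<bullet> (A *\<^sub>v x + B *\<^sub>v u))) = (\<Sum>k\<le>d. p k * (e (k + Suc j) \<bullet> x))"
      by simp
  qed (rule x)
  (* Coefficient of the input at distance t from the end of the window in the combined relation. *)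
  define G where "G t = Matrix.vec nu (\<lambda>s. \<Sum>r\<le>min d t. p (d - r) * F (t - r) $ s)" for t
  have G_prod: "G t \<bullet> v = (\<Sum>r\<le>min d t. p (d - r) * (F (t - r) \<bullet> v))" if v: "v \<in> carrier_vec nu" for t v
  proof -
    have "G t \<bullet> v = (\<Sum>s<nu. \<Sum>r\<le>min d t. p (d - r) * (F (t - r) $ s * v $ s))"
      using v by (simp add: G_def scalar_prod_def atLeast0LessThan sum_distrib_right mult.assoc)
    also have "\<dots> = (\<Sum>r\<le>min d t. p (d - r) * (F (t - r) \<bullet> v))"
      using v by (subst sum.swap) (simp add: scalar_prod_def atLeast0LessThan sum_distrib_left)
    finally show ?thesis .
  qed
  have G_window: "(\<Sum>t<L + d. G t \<bullet> ud (j + (L + d - Suc t))) = 0" if j: "j + (L + d) \<le> N" for j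
  proof -
    let ?f = "\<lambda>k i. p k * (F i \<bullet> ud (j + (L + k - Suc i)))"
    have "(\<Sum>t<L + d. G t \<bullet> ud (j + (L + d - Suc t))) =
        (\<Sum>t<L + d. \<Sum>r\<le>min d t. p (d - r) * (F (t - r) \<bullet> ud (j + (L + d - Suc t))))"
      using j by (intro sum.cong refl G_prod ud) auto
    also have "\<dots> = (\<Sum>(t, r)\<in>(SIGMA t:{..<L + d}. {..min d t}). p (d - r) * (F (t - r) \<bullet> ud (j + (L + d - Suc t))))"
      by (rule sum.Sigma) auto
    (* Group by the shift k = d - r of the relation and the position i = t - r in it. *)
    also have "\<dots> = (\<Sum>(k, i)\<in>(SIGMA k:{..d}. {..<L + k}). ?f k i)"
      by (rule sum.reindex_bij_witness[where i = "\<lambda>(k, i). (i + (d - k), d - k)" and j = "\<lambda>(t, r). (d - r, t - r)"])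
        auto
    also have "\<dots> = (\<Sum>k\<le>d. \<Sum>i<L + k. ?f k i)"
      by (rule sum.Sigma[symmetric]) auto
    also have "\<dots> = (\<Sum>k\<le>d. p k * (- (e k \<bullet> xd j)))"
    proof (intro sum.cong refl)
      fix k assume "k \<in> {..d}"
      then have "(\<Sum>i<L + k. F i \<bullet> ud (j + (L + k - Suc i))) = - (e k \<bullet> xd j)"
        using relation[of j k] j by (simp add: eq_neg_iff_add_eq_0 add.commute)
      then show "(\<Sum>i<L + k. ?f k i) = p k * (- (e k \<bullet> xd j))"
        by (simp add: sum_distrib_left[symmetric])
    qed
    also have "\<dots> = - (\<Sum>k\<le>d. p k * (e (k + 0) \<bullet> xd j))" by (simp add: sum_negf)
    also have "\<dots> = 0"
      using e_rec[of "xd j" 0] lti_trajectory_state_carrier[OF sys traj, of j] j by simp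
    finally show ?thesis .
  qed
  have G_low: "G t = 0\<^sub>v nu" if t: "t < L + d" for t
  proof -
    (* The relation read forwards in time and padded to the window length L + K. *)
    define g where "g s = (if s < L + d then G (L + d - Suc s) else 0\<^sub>v nu)" for s
    have g: "g s \<in> carrier_vec nu" for s by (simp add: g_def G_def)
    have "g (L + d - Suc t) = 0\<^sub>v nu"
    proof (rule persistently_exciting_annihilator[OF pe ud g])
      fix j assume j: "j + (L + K) \<le> N"
      have "(\<Sum>s<L + K. g s \<bullet> ud (j + s)) = (\<Sum>s<L + d. g s \<bullet> ud (j + s))"
        using d(1) ud j by (intro sum.mono_neutral_right) (auto simp: g_def)
      also have "\<dots> = (\<Sum>t<L + d. g (L + d - Suc t) \<bullet> ud (j + (L + d - Suc t)))"
        by (rule sum.nat_diff_reindex[symmetric])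
      also have "\<dots> = (\<Sum>t<L + d. G t \<bullet> ud (j + (L + d - Suc t)))"
        by (intro sum.cong refl) (auto simp: g_def Suc_diff_Suc)
      also have "\<dots> = 0" using G_window j d(1) by simp
      finally show "(\<Sum>s<L + K. g s \<bullet> ud (j + s)) = 0" .
    qed (use t d(1) in auto)
    moreover have "L + d - Suc t < L + d" "L + d - Suc (L + d - Suc t) = t" using t by auto
    ultimately show ?thesis by (simp only: g_def if_True)
  qed
  have conv: "(\<Sum>r\<le>min d t. p (d - r) * F (t - r) $ s) = 0" if s: "s < nu" for t s
  proof (cases "t < L + d")
    case True
    then have "G t $ s = 0" using G_low s by simp
    then show ?thesis using s by (simp add: G_def)
  next
    case False
    (* All indices t - r are at least L, so only costates enter and the recurrence applies. *)
    have "(\<Sum>r\<le>min d t. p (d - r) * F (t - r) $ s) = (\<Sum>r<Suc d. p (d - r) * h (d - r + (t - (L + d))) $ s)"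
    proof (intro sum.cong)
      fix r assume "r \<in> {..<Suc d}"
      then have "\<not> t - r < L" "t - r - L = d - r + (t - (L + d))" using False by auto
      then show "p (d - r) * F (t - r) $ s = p (d - r) * h (d - r + (t - (L + d))) $ s"
        by (simp add: F_def)
    qed (use False in auto)
    also have "\<dots> = (\<Sum>k<Suc d. p k * h (k + (t - (L + d))) $ s)"
      using sum.nat_diff_reindex[of "\<lambda>k. p k * h (k + (t - (L + d))) $ s" "Suc d"] by simp
    also have "\<dots> = (\<Sum>k\<le>d. p k * (h (k + (t - (L + d))) \<bullet> unit_vec nu s))"
      using s h by (simp add: lessThan_Suc_atMost)
    also have "\<dots> = 0"
      using rec[of "unit_vec nu s"] by (simp add: h_def e_def)
    finally show ?thesis .
  qed
  have F0: "F i = 0\<^sub>v nu" for i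
  proof (rule eq_vecI)
    fix s assume "s < dim_vec (0\<^sub>v nu :: rvec)"
    then show "F i $ s = 0\<^sub>v nu $ s"
      using monic_convolution_eq_0[of p d "\<lambda>i. F i $ s", OF d(2) conv] by simp
  qed (use F in simp)
  show "\<alpha> t = 0\<^sub>v nu" if "t < L" for t
    using F0[of "L - Suc t"] that by (simp add: F_def Suc_diff_Suc)
  have h0: "h k = 0\<^sub>v nu" for k using F0[of "L + k"] by (simp add: F_def)
  have "e 0 \<bullet> \<eta> = 0"
  proof (rule controllable_annihilator[OF ctrb A B, where l = "\<lambda>j x. e j \<bullet> x"])
    fix j and x u :: rvec
    assume "x \<in> carrier_vec nx" "u \<in> carrier_vec nu"
    then show "e j \<bullet> (A *\<^sub>v x + B *\<^sub>v u) = e (Suc j) \<bullet> x" using e_step h0 by simp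
  qed (use e \<eta> in auto)
  then show "\<eta> = 0\<^sub>v nx" using scalar_prod_self_eq_0_iff[OF \<eta>] by (simp add: e_def)
qed

text \<open>
  Willems' fundamental lemma with the McMillan degree. By double annihilation it is enough that a
  functional vanishing on the columns vanishes on every trajectory. After elimination of the outputs
  it is governed by Markov parameters, so a recurrence of order at most the McMillan degree is found
  in a realization of that dimension, although the given state space may be larger.
\<close>

lemma external_behavior_eq_hankel_range:
  assumes sys: "lti_system nx nu ny A B C D" and ctrb: "controllable A B"
    and traj: "lti_trajectory A B C D N xd ud yd"
    and K: "mcmillan_degree A B C D \<le> K"
    and pe: "persistently_exciting nu (L + K) N ud"
  shows "external_behavior A B C D L =
    (\<lambda>g. hankel (nu + ny) L N (\<lambda>t. ud t @\<^sub>v yd t) *\<^sub>v g) ` carrier_vec (N + 1 - L)"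
proof (intro subset_antisym image_subsetI subsetI)
  let ?H = "hankel (nu + ny) L N (\<lambda>t. ud t @\<^sub>v yd t)"
  have window: "lti_trajectory A B C D L (\<lambda>t. xd (j + t)) (\<lambda>t. ud (j + t)) (\<lambda>t. yd (j + t))"
    if "j + L \<le> N" for j
    by (rule lti_trajectory_window[OF sys traj that])
  show "?H *\<^sub>v g \<in> external_behavior A B C D L" if "g \<in> carrier_vec (N + 1 - L)" for g
  proof (rule mult_mat_vec_in_subspace[OF hankel_carrier that zero_in_external_behavior[OF sys]])
    fix j assume j: "j < N + 1 - L"
    then have "j + L \<le> N" by simp
    from window[OF this] show "col ?H j \<in> external_behavior A B C D L"
      unfolding col_hankel[OF j] external_behavior_iff[OF sys] by blast
  qed (auto intro: external_behavior_add[OF sys] external_behavior_smult[OF sys])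
  fix w assume "w \<in> external_behavior A B C D L"
  then obtain x u y where T: "lti_trajectory A B C D L x u y" and w: "w = stack (nu + ny) L (\<lambda>t. u t @\<^sub>v y t)"
    using external_behavior_iff[OF sys] by blast
  have "\<exists>g\<in>carrier_vec (N + 1 - L). w = ?H *\<^sub>v g"
  proof (rule in_range_if_annihilated[OF hankel_carrier])
    show "w \<in> carrier_vec (L * (nu + ny))" by (simp add: w)
    fix r assume r: "r \<in> carrier_vec (L * (nu + ny))" and ann: "\<And>j. j < N + 1 - L \<Longrightarrow> r \<bullet> col ?H j = 0"
    obtain a b where ab: "\<And>t. a t \<in> carrier_vec nu" "\<And>t. b t \<in> carrier_vec ny"
      and r_eq: "r = stack (nu + ny) L (\<lambda>t. a t @\<^sub>v b t)"
      by (rule stack_surj[OF r]) (rule that; assumption)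
    define \<eta> where "\<eta> = adjoint_state A C L b"
    obtain \<alpha> where \<alpha>: "\<And>t. \<alpha> t \<in> carrier_vec nu"
      and fnl: "\<And>x u y. lti_trajectory A B C D L x u y \<Longrightarrow>
        (\<Sum>t<L. a t \<bullet> u t + b t \<bullet> y t) = \<eta> \<bullet> x 0 + (\<Sum>t<L. \<alpha> t \<bullet> u t)"
      using external_functional_along_trajectory[of nx nu ny A B C D a b L, OF sys ab] unfolding \<eta>_def by blast
    have r_traj: "r \<bullet> stack (nu + ny) L (\<lambda>t. u t @\<^sub>v y t) = \<eta> \<bullet> x 0 + (\<Sum>t<L. \<alpha> t \<bullet> u t)"
      if T: "lti_trajectory A B C D L x u y" for x u y
    proof -
      note uy = lti_trajectory_signal_carrier[OF sys T]
      have "r \<bullet> stack (nu + ny) L (\<lambda>t. u t @\<^sub>v y t) = (\<Sum>t<L. (a t @\<^sub>v b t) \<bullet> (u t @\<^sub>v y t))"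
        unfolding r_eq using ab uy by (intro stack_scalar_prod) auto
      also have "\<dots> = (\<Sum>t<L. a t \<bullet> u t + b t \<bullet> y t)"
        using ab uy by (intro sum.cong refl scalar_prod_append) auto
      finally show ?thesis using fnl[OF T] by simp
    qed
    have car: "A \<in> carrier_mat nx nx" "C \<in> carrier_mat ny nx" using sys by (auto simp: lti_system_def)
    have \<eta>: "\<eta> \<in> carrier_vec nx" unfolding \<eta>_def using car ab by simp
    obtain A' B' C' D' where sys': "lti_system (mcmillan_degree A B C D) nu ny A' B' C' D'"
      and same: "same_transfer_function A B C D A' B' C' D'"
      using mcmillan_degree_realization[OF sys] .
    let ?m = "mcmillan_degree A B C D"
    have car': "A' \<in> carrier_mat ?m ?m" "B' \<in> carrier_mat ?m nu" "C' \<in> carrier_mat ny ?m"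
      using sys' by (auto simp: lti_system_def)
    define \<eta>' where "\<eta>' = adjoint_state A' C' L b"
    have \<eta>': "\<eta>' \<in> carrier_vec ?m" unfolding \<eta>'_def using car' ab by simp
    obtain d p where d: "d \<le> ?m" "p d = 1"
      and p: "\<And>j x. x \<in> carrier_vec ?m \<Longrightarrow> (\<Sum>k\<le>d. p k * (costate A' (k + j) \<eta>' \<bullet> x)) = 0"
      using costate_monic_recurrence[OF car'(1) \<eta>'] by blast
    have rec: "(\<Sum>k\<le>d. p k * ((B\<^sup>T *\<^sub>v costate A (k + j) \<eta>) \<bullet> v)) = 0" if v: "v \<in> carrier_vec nu" for j v
    proof -
      have "(B\<^sup>T *\<^sub>v costate A k \<eta>) \<bullet> v = costate A' k \<eta>' \<bullet> (B' *\<^sub>v v)" for k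
      proof -
        have "B\<^sup>T *\<^sub>v costate A k \<eta> = B'\<^sup>T *\<^sub>v costate A' k \<eta>'"
          unfolding \<eta>_def \<eta>'_def by (rule markov_parameters_adjoint_state_eq[OF sys sys' same ab(2)])
        then show ?thesis
          using transpose_vec_mult_scalar[OF car'(2) v costate_carrier[OF car'(1) \<eta>']] by simp
      qed
      moreover have "B' *\<^sub>v v \<in> carrier_vec ?m" using car' v by (auto intro!: mult_mat_vec_carrier)
      ultimately show ?thesis using p by simp
    qed
    have ann': "\<eta> \<bullet> xd j + (\<Sum>i<L. \<alpha> i \<bullet> ud (j + i)) = 0" if "j + L \<le> N" for j
      using ann[of j] r_traj[OF window[OF that]] that by (simp add: col_hankel)
    have "\<eta> = 0\<^sub>v nx" and "\<And>t. t < L \<Longrightarrow> \<alpha> t = 0\<^sub>v nu"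
      using hankel_annihilator_vanishes[OF sys ctrb traj pe \<eta> \<alpha> _ d(2) rec ann'] d(1) K by auto
    moreover have "x 0 \<in> carrier_vec nx" using lti_trajectory_state_carrier[OF sys T] by simp
    ultimately show "r \<bullet> w = 0"
      using r_traj[OF T] lti_trajectory_signal_carrier(1)[OF sys T] by (simp add: w)
  qed
  then show "w \<in> (\<lambda>g. ?H *\<^sub>v g) ` carrier_vec (N + 1 - L)" by blast
qed

section \<open>Infima over probability measures\<close>

lemma space_borel_vec [simp]: "space (borel_vec d) = carrier_vec d"
  by (simp add: borel_vec_def)

lemma measurable_vec_index:
  assumes "i < d"
  shows "(\<lambda>v. v $ i) \<in> borel_measurable (borel_vec d)"
proof -
  have "(\<lambda>v. \<lambda>i\<in>{..<d}. v $ i) \<in> borel_vec d \<rightarrow>\<^sub>M (\<Pi>\<^sub>M i\<in>{..<d}. borel :: real measure)"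
    unfolding borel_vec_def by (rule measurable_vimage_algebra1) (auto simp: space_PiM)
  from measurable_compose[OF this measurable_component_singleton[of i]] assms
  show ?thesis by simp
qed

lemma measurable_mult_mat_vec:
  assumes H: "H \<in> carrier_mat d p"
  shows "(\<lambda>g. H *\<^sub>v g) \<in> borel_vec p \<rightarrow>\<^sub>M borel_vec d"
proof -
  have "(\<lambda>g. \<lambda>i\<in>{..<d}. (H *\<^sub>v g) $ i) \<in> borel_vec p \<rightarrow>\<^sub>M (\<Pi>\<^sub>M i\<in>{..<d}. borel :: real measure)"
  proof (rule measurable_restrict)
    fix i assume i: "i \<in> {..<d}"
    have "(\<lambda>g. \<Sum>j<p. H $$ (i, j) * g $ j) \<in> borel_measurable (borel_vec p)"
      by (intro borel_measurable_sum borel_measurable_times measurable_vec_index) auto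
    also have "?this \<longleftrightarrow> (\<lambda>g. (H *\<^sub>v g) $ i) \<in> borel_measurable (borel_vec p)"
      using H i by (intro measurable_cong) (auto simp: scalar_prod_def atLeast0LessThan)
    finally show "(\<lambda>g. (H *\<^sub>v g) $ i) \<in> borel_measurable (borel_vec p)" .
  qed
  then show ?thesis
    unfolding borel_vec_def[of d] using H by (intro measurable_vimage_algebra2) auto
qed

text \<open>
  An average is at least the infimum, and Dirac measures attain the value at each point.
\<close>

lemma INF_borel_probs_eq_INF_points:
  fixes f :: "rvec \<Rightarrow> real"
  assumes S: "S \<noteq> {}" "S \<subseteq> carrier_vec d"
    and f: "f \<in> borel_measurable (borel_vec d)" and bdd: "bounded (f ` carrier_vec d)"
  shows "(INF \<mu>\<in>borel_probs d S. \<integral>w. f w \<partial>\<mu>) = (INF w\<in>S. f w)"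
proof -
  let ?R = "restrict_space (borel_vec d) S"
  have fR: "f \<in> borel_measurable ?R" by (rule measurable_restrict_space1[OF f])
  have spR: "space ?R = S" using S by (auto simp: space_restrict_space)
  obtain b where b: "\<And>w. w \<in> carrier_vec d \<Longrightarrow> \<bar>f w\<bar> \<le> b"
    using bdd by (auto simp: bounded_iff)
  have bddS: "bdd_below (f ` S)"
    using b S by (intro bdd_belowI[of _ "- b"]) (force simp: abs_le_iff)
  have lower: "(INF w\<in>S. f w) \<le> (\<integral>w. f w \<partial>\<mu>)" if "\<mu> \<in> borel_probs d S" for \<mu>
  proof -
    interpret prob_space \<mu> using that by (simp add: borel_probs_def)
    have sets: "sets \<mu> = sets ?R" using that by (simp add: borel_probs_def)
    have sp: "space \<mu> = S" using sets_eq_imp_space_eq[OF sets] spR by simp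
    have meas: "f \<in> borel_measurable \<mu>" using fR measurable_cong_sets[OF sets refl] by blast
    have "integrable \<mu> f"
      by (rule integrable_const_bound[where B = b]) (use b S sp meas in \<open>auto intro!: AE_I2\<close>)
    then show ?thesis
      by (rule integral_ge_const) (use sp bddS in \<open>auto intro!: AE_I2 cINF_lower\<close>)
  qed
  have dirac: "return ?R w \<in> borel_probs d S" "(\<integral>v. f v \<partial>return ?R w) = f w" if "w \<in> S" for w
    using that spR fR by (auto simp: borel_probs_def prob_space_return integral_return)
  have bddI: "bdd_below ((\<lambda>\<mu>. \<integral>w. f w \<partial>\<mu>) ` borel_probs d S)"
    using lower by (intro bdd_belowI2) auto
  show ?thesis
  proof (rule antisym)
    show "(INF w\<in>S. f w) \<le> (INF \<mu>\<in>borel_probs d S. \<integral>w. f w \<partial>\<mu>)"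
      using lower dirac(1) S(1) by (intro cINF_greatest) auto
    show "(INF \<mu>\<in>borel_probs d S. \<integral>w. f w \<partial>\<mu>) \<le> (INF w\<in>S. f w)"
    proof (rule cINF_greatest[OF S(1)])
      fix w assume w: "w \<in> S"
      show "(INF \<mu>\<in>borel_probs d S. \<integral>w. f w \<partial>\<mu>) \<le> f w"
        using cINF_lower[OF bddI dirac(1)[OF w]] dirac(2)[OF w] by simp
    qed
  qed
qed

theorem corollary4p11:
  fixes nx nu ny L N nbar :: nat
    and A B C D :: "real mat"
    and ud yd :: "nat \<Rightarrow> real Matrix.vec"
    and c :: "real Matrix.vec \<Rightarrow> real"
  assumes "lti_system nx nu ny A B C D"
    and "controllable A B"
    and "\<exists>xd. lti_trajectory A B C D N xd ud yd"
    and "mcmillan_degree A B C D \<le> nbar"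
    and "persistently_exciting nu (L + nbar) N ud"
    and "c \<in> borel_measurable (borel_vec (L * (nu + ny)))"
    and "bounded (c ` carrier_vec (L * (nu + ny)))"
  shows "(INF \<mu> \<in> borel_probs (L * (nu + ny)) (external_behavior A B C D L). \<integral>w. c w \<partial>\<mu>) =
         (INF \<nu> \<in> borel_probs (N + 1 - L) (carrier_vec (N + 1 - L)).
            \<integral>g. c (hankel (nu + ny) L N (\<lambda>t. ud t @\<^sub>v yd t) *\<^sub>v g) \<partial>\<nu>)"
proof -
  let ?H = "hankel (nu + ny) L N (\<lambda>t. ud t @\<^sub>v yd t)"
  let ?G = "carrier_vec (N + 1 - L) :: rvec set"
  obtain xd where traj: "lti_trajectory A B C D N xd ud yd" using assms(3) by blast
  have range: "external_behavior A B C D L = (\<lambda>g. ?H *\<^sub>v g) ` ?G"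
    by (rule external_behavior_eq_hankel_range[OF assms(1,2) traj assms(4,5)])
  have H_maps: "?H *\<^sub>v g \<in> carrier_vec (L * (nu + ny))" if "g \<in> ?G" for g
    by (rule mult_mat_vec_carrier[OF hankel_carrier that])
  have "(INF \<mu> \<in> borel_probs (L * (nu + ny)) (external_behavior A B C D L). \<integral>w. c w \<partial>\<mu>) =
      (INF w \<in> external_behavior A B C D L. c w)"
    using zero_in_external_behavior[OF assms(1)] external_behavior_carrier[OF assms(1)] assms(6,7)
    by (intro INF_borel_probs_eq_INF_points) auto
  also have "\<dots> = (INF g \<in> ?G. c (?H *\<^sub>v g))"
    unfolding range by (simp add: image_image)
  also have "\<dots> = (INF \<nu> \<in> borel_probs (N + 1 - L) ?G. \<integral>g. c (?H *\<^sub>v g) \<partial>\<nu>)"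
  proof (rule INF_borel_probs_eq_INF_points[symmetric])
    show "?G \<noteq> {}" using zero_carrier_vec by blast
    show "(\<lambda>g. c (?H *\<^sub>v g)) \<in> borel_measurable (borel_vec (N + 1 - L))"
      by (rule measurable_compose[OF measurable_mult_mat_vec[OF hankel_carrier] assms(6)])
    show "bounded ((\<lambda>g. c (?H *\<^sub>v g)) ` ?G)"
      using H_maps by (intro bounded_subset[OF assms(7)]) auto
  qed simp
  finally show ?thesis .
qed

end
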